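(* Let $A,Q\in\mathbb{R}^{n\times n}$ satisfy the structural stability condition in the normalized form described in the context and assume $\det(A)\neq0$. For $\epsilon>0$ let $\epsilon(x)=1$ for $x\le 0$ and $\epsilon(x)=\epsilon$ for $x>0$. If $U_0\in H^1(\mathbb{R})$, then there exists a solution $U^\epsilon=U^\epsilon(x,t)$ of the initial-value problem $$U_t+AU_x=\frac{1}{\epsilon(x)}QU,\quad x\in\mathbb{R},\ t>0,\qquad U(x,0)=U_0(x),$$ which satisfies $$\|U^\epsilon(\cdot,t)\|_{L^2(\mathbb{R})}\le \|U^\epsilon(\cdot,0)\|_{L^2(\mathbb{R})}$$ for every $\epsilon>0$ and every $t>0$.
   Context: Structural stability condition (normalized form used throughout the paper): $A$ is symmetric and $Q=\mathrm{diag}(0_{(n-m)\times(n-m)},S)$ with $S\in\mathbb{R}^{m\times m}$ symmetric negative definite. Solutions are understood in the weak sense: $\int_0^T\int_{\mathbb{R}}[\phi_t^TU+\phi_x^TAU+\epsilon(x)^{-1}\phi^TQU]\,dx\,dt=0$ for all test functions $\phi$ compactly supported in $\{t>0\}$ (with the initial condition). *)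

theory Defs
  imports "HOL-Analysis.Analysis"
begin

fun Ck_fun :: "nat \<Rightarrow> ('a::real_normed_vector \<Rightarrow> 'b::real_normed_vector) \<Rightarrow> bool" where
  "Ck_fun 0 f = continuous_on UNIV f"
| "Ck_fun (Suc k) f = (f differentiable_on UNIV \<and>
      (\<forall>v. Ck_fun k (\<lambda>x. frechet_derivative f (at x) v)))"

definition smooth_fun :: "('a::real_normed_vector \<Rightarrow> 'b::real_normed_vector) \<Rightarrow> bool" where
  "smooth_fun f \<longleftrightarrow> (\<forall>k. Ck_fun k f)"

definition tsupp :: "('a::real_normed_vector \<Rightarrow> 'b::real_normed_vector) \<Rightarrow> 'a set" where
  "tsupp f = closure {x. f x \<noteq> 0}"

definition test_fun_line :: "(real \<Rightarrow> 'b::real_normed_vector) \<Rightarrow> bool" where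
  "test_fun_line \<psi> \<longleftrightarrow> smooth_fun \<psi> \<and> compact (tsupp \<psi>)"

definition test_fun_pos :: "(real \<times> real \<Rightarrow> 'b::real_normed_vector) \<Rightarrow> bool" where
  "test_fun_pos \<phi> \<longleftrightarrow> smooth_fun \<phi> \<and> compact (tsupp \<phi>) \<and> tsupp \<phi> \<subseteq> {z. snd z > 0}"

definition in_L2 :: "(real \<Rightarrow> real^'n) \<Rightarrow> bool" where
  "in_L2 f \<longleftrightarrow> f \<in> borel_measurable lborel \<and> integrable lborel (\<lambda>x. (norm (f x))\<^sup>2)"

definition L2norm :: "(real \<Rightarrow> real^'n) \<Rightarrow> real" where
  "L2norm f = sqrt (integral\<^sup>L lborel (\<lambda>x. (norm (f x))\<^sup>2))"

definition in_H1 :: "(real \<Rightarrow> real^'n) \<Rightarrow> bool" where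
  "in_H1 f \<longleftrightarrow> in_L2 f \<and> (\<exists>g. in_L2 g \<and>
     (\<forall>\<psi> :: real \<Rightarrow> real^'n. test_fun_line \<psi> \<longrightarrow>
        integral\<^sup>L lborel (\<lambda>x. f x \<bullet> vector_derivative \<psi> (at x)) = - integral\<^sup>L lborel (\<lambda>x. g x \<bullet> \<psi> x)))"

text \<open>Structural stability condition, normalized form: A symmetric; Q symmetric, its nonzero
  entries lie in the block J x J where J is a final segment of the (linearly ordered) index
  type (i.e. the last m indices), and the block S = Q restricted to J is negative definite.\<close>
definition normalized_stability :: "real^('n::{finite,linorder})^('n::{finite,linorder}) \<Rightarrow> real^('n::{finite,linorder})^('n::{finite,linorder}) \<Rightarrow> bool" where
  "normalized_stability A Q \<longleftrightarrow>
     transpose A = A \<and>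
     (\<exists>J :: ('n::{finite,linorder}) set.
        (\<forall>i\<in>J. \<forall>j. i \<le> j \<longrightarrow> j \<in> J) \<and>
        (\<forall>i j. (i \<notin> J \<or> j \<notin> J) \<longrightarrow> Q $ i $ j = 0) \<and>
        (\<forall>i\<in>J. \<forall>j\<in>J. Q $ i $ j = Q $ j $ i) \<and>
        (\<forall>v :: real^('n::{finite,linorder}). (\<forall>i. i \<notin> J \<longrightarrow> v $ i = 0) \<and> v \<noteq> 0 \<longrightarrow> v \<bullet> (Q *v v) < 0))"

definition eps_fun :: "real \<Rightarrow> real \<Rightarrow> real" where
  "eps_fun \<epsilon> x = (if x \<le> 0 then 1 else \<epsilon>)"

text \<open>Weak solution U (U x t) of U_t + A U_x = eps(x)^{-1} Q U on R x (0,inf), U(x,0)=U0(x),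
  with U in C([0,inf); L^2(R)).\<close>
definition weak_solution ::
  "real^'n^'n \<Rightarrow> real^'n^'n \<Rightarrow> real \<Rightarrow> (real \<Rightarrow> real^'n) \<Rightarrow> (real \<Rightarrow> real \<Rightarrow> real^'n) \<Rightarrow> bool" where
  "weak_solution A Q \<epsilon> U0 U \<longleftrightarrow>
     (\<lambda>z. U (fst z) (snd z)) \<in> borel_measurable lborel \<and>
     (\<forall>t\<ge>0. in_L2 (\<lambda>x. U x t)) \<and>
     (\<forall>t0\<ge>0. ((\<lambda>t. integral\<^sup>L lborel (\<lambda>x. (norm (U x t - U x t0))\<^sup>2)) \<longlongrightarrow> 0)
                 (at t0 within {0..})) \<and>
     (\<forall>x. U x 0 = U0 x) \<and>
     (\<forall>\<phi> :: real \<times> real \<Rightarrow> real^'n. test_fun_pos \<phi> \<longrightarrow>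
        (let F = (\<lambda>z. frechet_derivative \<phi> (at z) (0,1) \<bullet> U (fst z) (snd z)
                     + frechet_derivative \<phi> (at z) (1,0) \<bullet> (A *v U (fst z) (snd z))
                     + (1 / eps_fun \<epsilon> (fst z)) * (\<phi> z \<bullet> (Q *v U (fst z) (snd z))))
         in integrable lborel F \<and> integral\<^sup>L lborel F = 0))"

end

theory Submission
  imports Defs
begin

text \<open>
  In an orthonormal eigenbasis of \<open>A\<close> the system is a family of transport equations coupled only
  through the bounded zeroth order term \<open>Q / \<epsilon>(x)\<close>. For bounded, compactly supported data the
  equations integrated along characteristics are solved by Picard iteration. Along each characteristic a
  component is the primitive of a bounded function, so integration by parts yields both the weak
  formulation and an identity for the square of that component. Summed over the components, the latter
  gives the decay of the \<open>L2\<close> norm, because \<open>Q\<close> is negative semidefinite. General \<open>L2\<close> data are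
  reached by truncation.
\<close>

subsection \<open>Orthonormal eigenbases\<close>

text \<open>The jump of \<open>eps_fun\<close> and the jumps of truncated data leave the solution
  without classical derivatives in x and t. Only a component along its own characteristic is
  regular: there it is the primitive of a bounded \<open>source\<close>. So all calculus is done in
  one variable on the lines x = y + lam e * t, and space-time integrals are carried to these lines
  by a measure-preserving shear. Truncation keeps all integrands bounded with bounded support, so
  Fubini applies. Different components travel along different lines, so the sign of Q does not show
  on a single line. It appears only after integrating over all feet y and summing over the
  eigenbasis. Continuity in time cannot come from smoothness either: following a characteristic from
  time t to t0 costs O(|t - t0|) and leaves a translate of a fixed slice, so continuity of
  translations in L1 is needed. The squared L2 errors are made of size (1/8)^n because a weight 2^n
  still leaves the summable (1/4)^n, while the remainder of the weighting is (1/2)^n. This serves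
  both almost everywhere convergence and the limit in the weak formulation.\<close>

text \<open>A maximiser of the Rayleigh quotient on the compact unit sphere of \<open>S\<close> is
  an eigenvector: its residual \<open>w = f v - M v\<close> lies in \<open>S\<close>, and moving
  from \<open>v\<close> towards \<open>w\<close> would increase the quotient unless \<open>w\<close>
  vanishes.\<close>

lemma self_adjoint_eigenvector:
  fixes f :: "'a::euclidean_space \<Rightarrow> 'a"
  assumes lin: "linear f" and sa: "\<And>x y. x \<bullet> f y = f x \<bullet> y"
    and S: "subspace S" "\<And>x. x \<in> S \<Longrightarrow> f x \<in> S" "S \<noteq> {0}"
  shows "\<exists>v\<in>S. norm v = 1 \<and> (\<exists>l. f v = l *\<^sub>R v)"
proof -
  have cont: "continuous_on A f" for A
    using lin by (simp add: linear_continuous_on linear_conv_bounded_linear)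
  have "compact (S \<inter> sphere 0 1)"
    by (intro closed_Int_compact closed_subspace[OF S(1)] compact_sphere)
  moreover have "S \<inter> sphere 0 1 \<noteq> {}"
  proof -
    obtain x where x: "x \<in> S" "x \<noteq> 0" using S(3) subspace_0[OF S(1)] by auto
    then have "x /\<^sub>R norm x \<in> S \<inter> sphere 0 1" using S(1) by (simp add: subspace_scale)
    then show ?thesis by blast
  qed
  moreover have "continuous_on (S \<inter> sphere 0 1) (\<lambda>v. v \<bullet> f v)"
    by (intro continuous_intros cont)
  ultimately obtain v where v: "v \<in> S \<inter> sphere 0 1"
      and vmax: "\<And>y. y \<in> S \<inter> sphere 0 1 \<Longrightarrow> y \<bullet> f y \<le> v \<bullet> f v"
    using continuous_attains_sup by metis
  define M where "M = v \<bullet> f v"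
  have vv: "v \<in> S" "norm v = 1" "v \<bullet> v = 1" using v by (auto simp: norm_eq_1)
  have maxM: "y \<bullet> f y \<le> M * (y \<bullet> y)" if "y \<in> S" for y
  proof (cases "y = 0")
    case False
    have "y /\<^sub>R norm y \<in> S \<inter> sphere 0 1" using S(1) that False by (simp add: subspace_scale)
    from vmax[OF this] have "(y \<bullet> f y) / (norm y)^2 \<le> M"
      unfolding M_def by (simp add: linear_cmul[OF lin] power2_eq_square divide_inverse ac_simps)
    then show ?thesis using False by (simp add: dot_square_norm divide_simps)
  qed simp
  define w where "w = f v - M *\<^sub>R v"
  have wS: "w \<in> S" unfolding w_def using S vv by (simp add: subspace_diff subspace_scale)
  have wv: "w \<bullet> v = 0" unfolding w_def M_def by (simp add: inner_diff_left inner_diff_right vv inner_commute)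
  have "w \<bullet> w = w \<bullet> f v - M * (w \<bullet> v)"
    by (subst (2) w_def) (simp add: inner_diff_right)
  then have wf: "w \<bullet> f v = w \<bullet> w" using wv by simp
  \<comment> \<open>The maximum property is tested at \<open>v + t *\<^sub>R w\<close>. The terms of
    order zero cancel; those of first order add up to twice \<open>t * (w \<bullet> w)\<close>,
    since \<open>w\<close> is orthogonal to \<open>v\<close> and self-adjointness turns
    \<open>v \<bullet> f w\<close> into \<open>w \<bullet> w\<close>.\<close>
  have ineq: "2 * t * (w \<bullet> w) \<le> t^2 * (M * (w \<bullet> w) - w \<bullet> f w)" for t
  proof -
    have "v + t *\<^sub>R w \<in> S" using S(1) vv wS by (simp add: subspace_add subspace_scale)
    from maxM[OF this]
    have "(v + t *\<^sub>R w) \<bullet> (f v + t *\<^sub>R f w) \<le> M * ((v + t *\<^sub>R w) \<bullet> (v + t *\<^sub>R w))"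
      by (simp add: linear_add[OF lin] linear_cmul[OF lin])
    moreover have "v \<bullet> f w = w \<bullet> w" using sa[of v w] wf by (simp add: inner_commute)
    ultimately show ?thesis using wv wf vv
      by (simp add: inner_add_left inner_add_right inner_commute M_def[symmetric] algebra_simps power2_eq_square)
  qed
  have "w \<bullet> w = 0"
  proof (rule ccontr)
    assume "w \<bullet> w \<noteq> 0"
    then have p: "w \<bullet> w > 0" by simp
    \<comment> \<open>A positive bound for the second order coefficient. At t = (w . w) / K the
      inequality would read 2 t (w . w) <= t (w . w).\<close>
    define K where "K = \<bar>M * (w \<bullet> w) - w \<bullet> f w\<bar> + 1"
    have K: "K > 0" "M * (w \<bullet> w) - w \<bullet> f w \<le> K" unfolding K_def by linarith+
    define t where "t = (w \<bullet> w) / K"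
    have t: "t > 0" "t * K = w \<bullet> w" unfolding t_def using p K(1) by auto
    have "2 * t * (w \<bullet> w) \<le> t^2 * K"
      using ineq[of t] K(2) mult_left_mono[OF K(2), of "t^2"] by simp
    also have "\<dots> = t * (w \<bullet> w)" using t(2) by (simp add: power2_eq_square mult.assoc)
    finally show False using t(1) p by simp
  qed
  then have "f v = M *\<^sub>R v" unfolding w_def by simp
  then show ?thesis using vv by blast
qed

text \<open>Eigenvectors are split off one at a time: by self-adjointness the orthogonal complement
  of an eigenvector inside an invariant subspace is again invariant, and its dimension is smaller.
  The expansion clause expresses completeness of the basis.\<close>

lemma self_adjoint_orthonormal_eigenbasis:
  fixes f :: "'a::euclidean_space \<Rightarrow> 'a"
  assumes lin: "linear f" and sa: "\<And>x y. x \<bullet> f y = f x \<bullet> y"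
  shows "\<exists>E. finite E \<and> (\<forall>e\<in>E. \<forall>e'\<in>E. e \<bullet> e' = (if e = e' then 1 else 0)) \<and>
    (\<forall>v. (\<Sum>e\<in>E. (e \<bullet> v) *\<^sub>R e) = v) \<and> (\<forall>e\<in>E. \<exists>l. f e = l *\<^sub>R e)"
proof -
  \<comment> \<open>Generalised to all invariant subspaces so that the induction on the dimension
    goes through; \<open>UNIV\<close> gives the lemma.\<close>
  have "subspace S \<longrightarrow> f ` S \<subseteq> S \<longrightarrow> (\<exists>E\<subseteq>S. finite E \<and>
      (\<forall>e\<in>E. \<forall>e'\<in>E. e \<bullet> e' = (if e = e' then 1 else 0)) \<and>
      (\<forall>v\<in>S. (\<Sum>e\<in>E. (e \<bullet> v) *\<^sub>R e) = v) \<and> (\<forall>e\<in>E. \<exists>l. f e = l *\<^sub>R e))" for S :: "'a set"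
  proof (induction "dim S" arbitrary: S rule: less_induct)
    case less
    show ?case
    proof (intro impI)
      assume S: "subspace S" "f ` S \<subseteq> S"
      show "\<exists>E\<subseteq>S. finite E \<and>
        (\<forall>e\<in>E. \<forall>e'\<in>E. e \<bullet> e' = (if e = e' then 1 else 0)) \<and>
        (\<forall>v\<in>S. (\<Sum>e\<in>E. (e \<bullet> v) *\<^sub>R e) = v) \<and> (\<forall>e\<in>E. \<exists>l. f e = l *\<^sub>R e)"
      proof (cases "S = {0}")
        case True
        then show ?thesis by (intro exI[of _ "{}"]) auto
      next
        case False
        obtain v l where v: "v \<in> S" "norm v = 1" "f v = l *\<^sub>R v"
          using self_adjoint_eigenvector[OF lin sa S(1) _ False] S(2) by blast
        define S' where "S' = {x \<in> S. v \<bullet> x = 0}"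
        have sub: "subspace S'"
          using S(1) unfolding S'_def subspace_def by (auto simp: inner_add_right)
        have vv: "v \<bullet> v = 1" using v(2) by (simp add: norm_eq_1)
        have "v \<notin> S'" using vv unfolding S'_def by simp
        then have "S' \<subset> S" using v(1) unfolding S'_def by blast
        then have dimlt: "dim S' < dim S"
          using dim_psubset[of S' S] span_eq_iff[THEN iffD2, OF sub] span_eq_iff[THEN iffD2, OF S(1)] by simp
        have inv: "f ` S' \<subseteq> S'"
          using S(2) sa[of v] v(3) unfolding S'_def by auto
        from less[OF dimlt, THEN mp, OF sub, THEN mp, OF inv]
        obtain E where E: "E \<subseteq> S'" "finite E"
          "\<forall>e\<in>E. \<forall>e'\<in>E. e \<bullet> e' = (if e = e' then 1 else 0)"
          "\<forall>v\<in>S'. (\<Sum>e\<in>E. (e \<bullet> v) *\<^sub>R e) = v" "\<forall>e\<in>E. \<exists>l. f e = l *\<^sub>R e"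
          by (elim exE conjE)
        have perp: "e \<bullet> v = 0" if "e \<in> E" for e
          using that E(1) unfolding S'_def by (auto simp: inner_commute)
        have vE: "v \<notin> E" using perp vv by force
        have "(\<Sum>e\<in>insert v E. (e \<bullet> x) *\<^sub>R e) = x" if "x \<in> S" for x
        proof -
          have "x - (v \<bullet> x) *\<^sub>R v \<in> S'"
            using that v S(1) vv unfolding S'_def
            by (simp add: subspace_diff subspace_scale inner_diff_right)
          from bspec[OF E(4) this] have "(\<Sum>e\<in>E. (e \<bullet> x) *\<^sub>R e) = x - (v \<bullet> x) *\<^sub>R v"
            by (simp add: inner_diff_right perp)
          then show ?thesis using vE E(2) by simp
        qed
        moreover have "\<forall>e\<in>insert v E. \<forall>e'\<in>insert v E. e \<bullet> e' = (if e = e' then 1 else 0)"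
          using E(3) perp vv vE by (auto simp: inner_commute)
        ultimately show ?thesis
          using E v unfolding S'_def by (intro exI[of _ "insert v E"]) auto
      qed
    qed
  qed
  from this[of UNIV] show ?thesis by simp
qed

subsection \<open>Integration\<close>

lemma integrable_bounded_indicator:
  fixes f :: "'b::euclidean_space \<Rightarrow> 'a::{banach,second_countable_topology}"
  assumes [measurable]: "f \<in> borel_measurable borel" and A[measurable]: "A \<in> sets borel" and "bounded A"
    and b: "\<And>x. x \<in> A \<Longrightarrow> norm (f x) \<le> M"
  shows "integrable lborel (\<lambda>x. indicator A x *\<^sub>R f x)"
proof -
  have "emeasure lborel A < \<infinity>" using emeasure_bounded_finite[OF \<open>bounded A\<close>] by auto
  then have "set_integrable lborel A (\<lambda>x. f x)"
    unfolding set_integrable_def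
    by (intro integrableI_bounded_set_indicator[where B = M]) (use b in auto)
  then show ?thesis by (simp add: set_integrable_def)
qed

lemma integrable_bounded_support:
  fixes f :: "'b::euclidean_space \<Rightarrow> 'a::{banach,second_countable_topology}"
  assumes m: "f \<in> borel_measurable borel" and A: "A \<in> sets borel" "bounded A"
    and b: "\<And>x. x \<in> A \<Longrightarrow> norm (f x) \<le> M" and z: "\<And>x. x \<notin> A \<Longrightarrow> f x = 0"
  shows "integrable lborel f"
proof -
  have "(\<lambda>x. indicator A x *\<^sub>R f x) = f" using z by (auto simp: indicator_def fun_eq_iff)
  then show ?thesis using integrable_bounded_indicator[OF m A b] by simp
qed

text \<open>Fubini on the square, split along the diagonal.\<close>

lemma integral_by_parts_primitives:
  fixes f g :: "real \<Rightarrow> real"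
  assumes mf[measurable]: "f \<in> borel_measurable borel" and mg[measurable]: "g \<in> borel_measurable borel"
    and bf: "\<And>s. 0 \<le> s \<Longrightarrow> s \<le> T \<Longrightarrow> \<bar>f s\<bar> \<le> M" and bg: "\<And>s. 0 \<le> s \<Longrightarrow> s \<le> T \<Longrightarrow> \<bar>g s\<bar> \<le> M"
  shows "(\<integral>t. indicator {0..T} t * (f t * (\<integral>s. indicator {0..t} s * g s \<partial>lborel)) \<partial>lborel)
       + (\<integral>t. indicator {0..T} t * (g t * (\<integral>s. indicator {0..t} s * f s \<partial>lborel)) \<partial>lborel)
       = (\<integral>t. indicator {0..T} t * f t \<partial>lborel) * (\<integral>t. indicator {0..T} t * g t \<partial>lborel)"
proof -
  define H where "H p = indicator {0..T} (fst p) * indicator {0..T} (snd p) * (f (fst p) * g (snd p))" for p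
  \<comment> \<open>Both triangles are closed, so that both inner integrals run over the closed
    interval \<open>{0..t}\<close>. They overlap on the diagonal, which is a null set; hence the
    almost everywhere equality below.\<close>
  define H1 where "H1 p = (if snd p \<le> fst p then H p else 0)" for p
  define H2 where "H2 p = (if fst p \<le> snd p then H p else 0)" for p
  have mH[measurable]: "H \<in> borel_measurable (lborel \<Otimes>\<^sub>M lborel)" unfolding H_def by measurable
  have mH1[measurable]: "H1 \<in> borel_measurable (lborel \<Otimes>\<^sub>M lborel)" unfolding H1_def by measurable
  have mH2[measurable]: "H2 \<in> borel_measurable (lborel \<Otimes>\<^sub>M lborel)" unfolding H2_def by measurable
  have intf: "integrable lborel (\<lambda>t. indicator {0..T} t * f t)"
    using integrable_bounded_indicator[of f "{0..T}" M] bf by auto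
  have intg: "integrable lborel (\<lambda>t. indicator {0..T} t * g t)"
    using integrable_bounded_indicator[of g "{0..T}" M] bg by auto
  have iH: "integrable (lborel \<Otimes>\<^sub>M lborel) H"
  proof (rule lborel_pair.Fubini_integrable[OF mH])
    have "(\<lambda>x. \<integral>y. norm (H (x, y)) \<partial>lborel)
       = (\<lambda>x. \<bar>indicator {0..T} x * f x\<bar> * (\<integral>y. \<bar>indicator {0..T} y * g y\<bar> \<partial>lborel))"
      unfolding H_def by (subst integral_mult_right_zero[symmetric]) (auto simp: abs_mult ac_simps)
    then show "integrable lborel (\<lambda>x. \<integral>y. norm (H (x, y)) \<partial>lborel)"
      using intf by (simp add: integrable_abs)
    have "(\<lambda>y. H (x, y)) = (\<lambda>y. (indicator {0..T} x * f x) * (indicator {0..T} y * g y))" for x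
      unfolding H_def by (auto simp: ac_simps)
    then show "AE x in lborel. integrable lborel (\<lambda>y. H (x, y))" using intg by simp
  qed
  have i1: "integrable (lborel \<Otimes>\<^sub>M lborel) H1" and i2: "integrable (lborel \<Otimes>\<^sub>M lborel) H2"
    by (auto intro!: Bochner_Integration.integrable_bound[OF iH] simp: H1_def H2_def)
  have "(\<integral>t. indicator {0..T} t * f t \<partial>lborel) * (\<integral>t. indicator {0..T} t * g t \<partial>lborel)
     = (\<integral>x. (\<integral>y. H (x,y) \<partial>lborel) \<partial>lborel)"
  proof -
    have "(\<integral>y. H (x,y) \<partial>lborel) = (indicator {0..T} x * f x) * (\<integral>t. indicator {0..T} t * g t \<partial>lborel)" for x
    proof -
      have "(\<lambda>y. H (x,y)) = (\<lambda>y. (indicator {0..T} x * f x) * (indicator {0..T} y * g y))"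
        unfolding H_def by (auto simp: indicator_def)
      then show ?thesis by simp
    qed
    then show ?thesis by simp
  qed
  also have "\<dots> = integral\<^sup>L (lborel \<Otimes>\<^sub>M lborel) H" using lborel_pair.integral_fst'[OF iH] by simp
  also have "\<dots> = integral\<^sup>L (lborel \<Otimes>\<^sub>M lborel) (\<lambda>p. H1 p + H2 p)"
  proof (rule integral_cong_AE)
    have "AE p in lborel \<Otimes>\<^sub>M lborel. fst p \<noteq> (snd p :: real)"
    proof (rule lborel_pair.AE_pair_measure)
      show "{p \<in> space (lborel \<Otimes>\<^sub>M lborel). fst p \<noteq> (snd p :: real)} \<in> sets (lborel \<Otimes>\<^sub>M lborel)"
        by measurable
      show "AE x in lborel. AE y in lborel. fst (x, y) \<noteq> (snd (x, y) :: real)"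
      proof (rule AE_I2)
        fix x :: real
        show "AE y in lborel. fst (x, y) \<noteq> (snd (x, y) :: real)"
          using AE_lborel_singleton[of x] by eventually_elim simp
      qed
    qed
    then show "AE p in lborel \<Otimes>\<^sub>M lborel. H p = H1 p + H2 p"
      by eventually_elim (auto simp: H1_def H2_def)
  qed auto
  also have "\<dots> = integral\<^sup>L (lborel \<Otimes>\<^sub>M lborel) H1 + integral\<^sup>L (lborel \<Otimes>\<^sub>M lborel) H2"
    using i1 i2 by simp
  also have "integral\<^sup>L (lborel \<Otimes>\<^sub>M lborel) H1 = (\<integral>x. (\<integral>y. H1 (x,y) \<partial>lborel) \<partial>lborel)"
    using lborel_pair.integral_fst'[OF i1] by simp
  also have "\<dots> = (\<integral>t. indicator {0..T} t * (f t * (\<integral>s. indicator {0..t} s * g s \<partial>lborel)) \<partial>lborel)"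
  proof (rule Bochner_Integration.integral_cong[OF refl])
    fix x :: real
    have "(\<lambda>y. H1 (x,y)) = (\<lambda>y. (indicator {0..T} x * f x) * (indicator {0..x} y * g y))"
      unfolding H1_def H_def by (auto simp: indicator_def)
    then show "(\<integral>y. H1 (x,y) \<partial>lborel) = indicator {0..T} x * (f x * (\<integral>s. indicator {0..x} s * g s \<partial>lborel))"
      by simp
  qed
  also have "integral\<^sup>L (lborel \<Otimes>\<^sub>M lborel) H2 = (\<integral>y. (\<integral>x. H2 (x,y) \<partial>lborel) \<partial>lborel)"
    using lborel_pair.integral_snd[of "\<lambda>x y. H2 (x,y)"] i2 by simp
  also have "\<dots> = (\<integral>t. indicator {0..T} t * (g t * (\<integral>s. indicator {0..t} s * f s \<partial>lborel)) \<partial>lborel)"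
  proof (rule Bochner_Integration.integral_cong[OF refl])
    fix x :: real
    have "(\<lambda>y. H2 (y,x)) = (\<lambda>y. (indicator {0..T} x * g x) * (indicator {0..x} y * f y))"
      unfolding H2_def H_def by (auto simp: indicator_def)
    then show "(\<integral>y. H2 (y,x) \<partial>lborel) = indicator {0..T} x * (g x * (\<integral>s. indicator {0..x} s * f s \<partial>lborel))"
      by simp
  qed
  finally show ?thesis by simp
qed

lemma integrable_bounded_Icc:
  fixes f :: "real \<Rightarrow> real"
  assumes "f \<in> borel_measurable borel" "\<And>s. 0 \<le> s \<Longrightarrow> s \<le> T \<Longrightarrow> \<bar>f s\<bar> \<le> M"
  shows "integrable lborel (\<lambda>s. indicator {0..T} s * f s)"
proof -
  have "integrable lborel (\<lambda>s. indicator {0..T} s *\<^sub>R f s)"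
    by (rule integrable_bounded_indicator[where M = M]) (use assms in auto)
  then show ?thesis by simp
qed

section \<open>Translations, shears and functions supported in a space-time box\<close>

lemma integrable_translate:
  fixes f :: "real \<Rightarrow> 'a::{banach,second_countable_topology}"
  assumes "integrable lborel f" shows "integrable lborel (\<lambda>x. f (x + h))"
  using lborel_integrable_real_affine[OF assms, of 1 h] by (simp add: add.commute)

lemma integral_translate:
  fixes f :: "real \<Rightarrow> 'a::{banach,second_countable_topology}"
  shows "(\<integral>x. f (x + h) \<partial>lborel) = (\<integral>x. f x \<partial>lborel)"
  using lborel_integral_real_affine[of 1 f h] by (simp add: add.commute)

lemma borel_measurable_compose_Pair:
  fixes w :: "'b::second_countable_topology \<times> 'c::second_countable_topology \<Rightarrow> 'd::topological_space"
  assumes "w \<in> borel_measurable borel" "f \<in> borel_measurable M" "g \<in> borel_measurable M"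
  shows "(\<lambda>x. w (f x, g x)) \<in> borel_measurable M"
  by (rule measurable_compose[OF borel_measurable_Pair[OF assms(2,3)] assms(1)])

lemma borel_measurable_indicator_Icc:
  fixes f g h :: "'b \<Rightarrow> real"
  assumes [measurable]: "f \<in> borel_measurable M" "g \<in> borel_measurable M" "h \<in> borel_measurable M"
  shows "(\<lambda>x. indicator {f x..g x} (h x) :: real) \<in> borel_measurable M"
  unfolding indicator_def atLeastAtMost_iff by measurable

lemma integrable_bounded_box:
  fixes g :: "real \<times> real \<Rightarrow> real"
  assumes "g \<in> borel_measurable borel" "\<And>x t. \<bar>x\<bar> \<le> R \<Longrightarrow> 0 \<le> t \<Longrightarrow> t \<le> T \<Longrightarrow> \<bar>g (x, t)\<bar> \<le> M"
    and "\<And>x t. \<not> (\<bar>x\<bar> \<le> R \<and> 0 \<le> t \<and> t \<le> T) \<Longrightarrow> g (x, t) = 0"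
  shows "integrable lborel g"
proof (rule integrable_bounded_support[where A = "{-R..R} \<times> {0..T}" and M = M])
  show "{-R..R} \<times> {0..T} \<in> sets borel" by (intro borel_closed closed_Times) auto
  show "bounded ({-R..R} \<times> {0..T})" by (intro bounded_Times) auto
  fix z :: "real \<times> real"
  show "norm (g z) \<le> M" if "z \<in> {-R..R} \<times> {0..T}"
    using assms(2)[of "fst z" "snd z"] that by (auto simp: mem_Times_iff abs_le_iff)
  show "g z = 0" if "z \<notin> {-R..R} \<times> {0..T}"
    using assms(3)[of "fst z" "snd z"] that by (auto simp: mem_Times_iff abs_le_iff)
qed (rule assms(1))

text \<open>The shear (y, t) -> (y + c t, t) preserves Lebesgue measure, because at each fixed t it
  is a translation. This passes from integrals over space-time to integrals along the
  characteristics with foot y.\<close>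

lemma integral_along_characteristics:
  fixes g :: "real \<times> real \<Rightarrow> real"
  assumes g: "g \<in> borel_measurable borel" and b: "\<And>x t. \<bar>x\<bar> \<le> R \<Longrightarrow> 0 \<le> t \<Longrightarrow> t \<le> T \<Longrightarrow> \<bar>g (x, t)\<bar> \<le> M"
    and z: "\<And>x t. \<not> (\<bar>x\<bar> \<le> R \<and> 0 \<le> t \<and> t \<le> T) \<Longrightarrow> g (x, t) = 0"
  shows "integral\<^sup>L lborel g = (\<integral>y. (\<integral>t. g (y + c * t, t) \<partial>lborel) \<partial>lborel)"
    and "integrable lborel (\<lambda>y. \<integral>t. g (y + c * t, t) \<partial>lborel)"
proof -
  define g' where "g' = (\<lambda>z. g (fst z + c * snd z, snd z))"
  have ig: "integrable lborel g" by (rule integrable_bounded_box[OF assms])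
  have ig': "integrable lborel g'"
  \<comment> \<open>The sheared box fits into a box wider by the largest shift, |c| T. Points of
    that larger box may come from outside the original one, where the value is 0, hence
    \<open>max M 0\<close>.\<close>
  proof (rule integrable_bounded_box[where R = "R + \<bar>c\<bar> * T" and T = T and M = "max M 0"])
    show "g' \<in> borel_measurable borel" unfolding g'_def
      by (intro borel_measurable_compose_Pair[OF g] borel_measurable_continuous_onI continuous_intros)
    show "\<bar>g' (x, t)\<bar> \<le> max M 0" for x t
      using b[of "x + c * t" t] z[of "x + c * t" t] unfolding g'_def by fastforce
    show "g' (x, t) = 0" if "\<not> (\<bar>x\<bar> \<le> R + \<bar>c\<bar> * T \<and> 0 \<le> t \<and> t \<le> T)" for x t
    proof -
      have "\<not> (\<bar>x + c * t\<bar> \<le> R \<and> 0 \<le> t \<and> t \<le> T)"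
      proof
        assume *: "\<bar>x + c * t\<bar> \<le> R \<and> 0 \<le> t \<and> t \<le> T"
        then have "\<bar>c * t\<bar> \<le> \<bar>c\<bar> * T" by (simp add: abs_mult mult_left_mono)
        then show False using * that by linarith
      qed
      then show ?thesis unfolding g'_def using z[of "x + c * t" t] by simp
    qed
  qed
  note ig2 = ig[unfolded lborel_prod[symmetric]] and ig2' = ig'[unfolded lborel_prod[symmetric]]
  have "(\<integral>y. (\<integral>t. g (y + c * t, t) \<partial>lborel) \<partial>lborel) = (\<integral>y. (\<integral>t. g' (y, t) \<partial>lborel) \<partial>lborel)"
    by (simp add: g'_def)
  also have "\<dots> = (\<integral>t. (\<integral>y. g' (y, t) \<partial>lborel) \<partial>lborel)"
    using lborel_pair.Fubini_integral[of "\<lambda>y t. g' (y, t)"] ig2' by simp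
  also have "\<dots> = (\<integral>t. (\<integral>y. g (y, t) \<partial>lborel) \<partial>lborel)"
    unfolding g'_def fst_conv snd_conv by (subst integral_translate[of "\<lambda>y. g (y, _)"]) rule
  also have "\<dots> = integral\<^sup>L (lborel \<Otimes>\<^sub>M lborel) g"
    using lborel_pair.integral_snd[of "\<lambda>y t. g (y, t)"] ig2 by simp
  finally show "integral\<^sup>L lborel g = (\<integral>y. (\<integral>t. g (y + c * t, t) \<partial>lborel) \<partial>lborel)"
    by (simp add: lborel_prod)
  show "integrable lborel (\<lambda>y. \<integral>t. g (y + c * t, t) \<partial>lborel)"
    using lborel_pair.integrable_fst'[OF ig2'] by (simp add: g'_def)
qed

lemma bounded_if_continuous_compact_support:
  fixes f :: "'b::heine_borel \<Rightarrow> 'c::real_normed_vector"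
  assumes "continuous_on K f" "compact K" "\<And>z. z \<notin> K \<Longrightarrow> f z = 0"
  obtains N where "N \<ge> 0" "\<And>z. norm (f z) \<le> N"
proof -
  obtain N where N: "\<And>z. z \<in> K \<Longrightarrow> norm (f z) \<le> N"
    using compact_imp_bounded[OF compact_continuous_image[OF assms(1,2)]] unfolding bounded_iff by auto
  have "norm (f z) \<le> max N 0" for z
    using N[of z] assms(3)[of z] by (cases "z \<in> K") auto
  then show ?thesis using that[of "max N 0"] by simp
qed

subsection \<open>Continuity of translations in L1\<close>

text \<open>L1 is enough for the L2 continuity needed later: for functions bounded by M, the square
  of a difference is at most 2 M times its absolute value.\<close>

definition L1_translation_continuous :: "(real \<Rightarrow> real) \<Rightarrow> bool" where
  "L1_translation_continuous f \<longleftrightarrow> ((\<lambda>h. \<integral>x. \<bar>f (x + h) - f x\<bar> \<partial>lborel) \<longlongrightarrow> 0) (at 0)"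

text \<open>A three-term estimate: by translation invariance the two outer terms both equal the L1
  distance of \<open>f\<close> and \<open>g\<close>, uniformly in the shift, and the middle term
  tends to zero.\<close>

lemma L1_translation_continuous_approx:
  assumes f: "integrable lborel f"
    and app: "\<And>\<epsilon>. \<epsilon> > 0 \<Longrightarrow> \<exists>g. integrable lborel g \<and> L1_translation_continuous g \<and> (\<integral>x. \<bar>f x - g x\<bar> \<partial>lborel) < \<epsilon>"
  shows "L1_translation_continuous f"
  unfolding L1_translation_continuous_def
proof (rule tendstoI)
  fix \<epsilon> :: real assume "\<epsilon> > 0"
  then obtain g where g: "integrable lborel g" "L1_translation_continuous g" "(\<integral>x. \<bar>f x - g x\<bar> \<partial>lborel) < \<epsilon>/3"
    using app[of "\<epsilon>/3"] by auto
  have "\<forall>\<^sub>F h in at 0. dist (\<integral>x. \<bar>g (x + h) - g x\<bar> \<partial>lborel) 0 < \<epsilon>/3"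
    using g(2) \<open>\<epsilon> > 0\<close> unfolding L1_translation_continuous_def by (intro tendstoD) auto
  then show "\<forall>\<^sub>F h in at 0. dist (\<integral>x. \<bar>f (x + h) - f x\<bar> \<partial>lborel) 0 < \<epsilon>"
  proof eventually_elim
    case (elim h)
    note i = integrable_abs Bochner_Integration.integrable_diff f g(1) integrable_translate[OF f] integrable_translate[OF g(1)]
    have iA: "integrable lborel (\<lambda>x. \<bar>f (x + h) - g (x + h)\<bar>)" by (intro i)
    have iB: "integrable lborel (\<lambda>x. \<bar>g (x + h) - g x\<bar>)" by (intro i)
    have iC: "integrable lborel (\<lambda>x. \<bar>f x - g x\<bar>)" by (intro i)
    have iD: "integrable lborel (\<lambda>x. \<bar>f (x + h) - f x\<bar>)" by (intro i)
    have "(\<integral>x. \<bar>f (x + h) - f x\<bar> \<partial>lborel)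
      \<le> (\<integral>x. \<bar>f (x + h) - g (x + h)\<bar> + \<bar>g (x + h) - g x\<bar> + \<bar>f x - g x\<bar> \<partial>lborel)"
      using iA iB iC iD by (intro integral_mono Bochner_Integration.integrable_add) linarith+
    also have "\<dots> = (\<integral>x. \<bar>f (x + h) - g (x + h)\<bar> \<partial>lborel) + (\<integral>x. \<bar>g (x + h) - g x\<bar> \<partial>lborel) + (\<integral>x. \<bar>f x - g x\<bar> \<partial>lborel)"
      using iA iB iC by simp
    also have "(\<integral>x. \<bar>f (x + h) - g (x + h)\<bar> \<partial>lborel) = (\<integral>x. \<bar>f x - g x\<bar> \<partial>lborel)"
      by (rule integral_translate[where f = "\<lambda>x. \<bar>f x - g x\<bar>"])
    finally show ?case using g(3) elim by simp
  qed
qed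

text \<open>By lower semicontinuity of the indicator, the positive part of the difference tends to zero
  pointwise; the negative part has the same integral.\<close>
lemma L1_translation_continuous_open:
  fixes S :: "real set"
  assumes S: "open S" "emeasure lborel S < \<infinity>"
  shows "L1_translation_continuous (indicator S)"
proof -
  let ?i = "indicator S :: real \<Rightarrow> real"
  have [measurable]: "S \<in> sets borel" using S by simp
  have i: "integrable lborel ?i" using S by simp
  have eq: "(\<integral>x. \<bar>?i (x + h) - ?i x\<bar> \<partial>lborel) = 2 * (\<integral>x. max 0 (?i x - ?i (x + h)) \<partial>lborel)" for h
  proof -
    have i': "integrable lborel (\<lambda>x. ?i (x + h))" by (rule integrable_translate[OF i])
    have im: "integrable lborel (\<lambda>x. max 0 (?i x - ?i (x + h)))"
      using i i' by (intro integrable_max) auto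
    have "(\<integral>x. \<bar>?i (x + h) - ?i x\<bar> \<partial>lborel) = (\<integral>x. 2 * max 0 (?i x - ?i (x + h)) + (?i (x + h) - ?i x) \<partial>lborel)"
      by (intro Bochner_Integration.integral_cong) (auto simp: indicator_def)
    also have "\<dots> = 2 * (\<integral>x. max 0 (?i x - ?i (x + h)) \<partial>lborel)"
      using i i' im integral_translate[of ?i h] by simp
    finally show ?thesis .
  qed
  have "((\<lambda>h. \<integral>x. max 0 (?i x - ?i (x + h)) \<partial>lborel) \<longlongrightarrow> 0) (at 0)"
    unfolding tendsto_at_iff_sequentially comp_def
  proof (intro allI impI)
    fix X :: "nat \<Rightarrow> real" assume X: "X \<longlonglongrightarrow> 0"
    have "(\<lambda>n. \<integral>x. max 0 (?i x - ?i (x + X n)) \<partial>lborel) \<longlonglongrightarrow> (\<integral>x. 0 \<partial>(lborel::real measure))"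
    proof (rule integral_dominated_convergence[where w = ?i])
      show "AE x in lborel. (\<lambda>n. max 0 (?i x - ?i (x + X n))) \<longlonglongrightarrow> 0"
      proof (intro AE_I2)
        fix x :: real
        show "(\<lambda>n. max 0 (?i x - ?i (x + X n))) \<longlonglongrightarrow> 0"
        proof (cases "x \<in> S")
          case True
          have "(\<lambda>n. x + X n) \<longlonglongrightarrow> x + 0" by (intro tendsto_intros X)
          then have "\<forall>\<^sub>F n in sequentially. x + X n \<in> S" using S(1) True topological_tendstoD by fastforce
          then have "\<forall>\<^sub>F n in sequentially. max 0 (?i x - ?i (x + X n)) = 0"
            by eventually_elim (use True in auto)
          then show ?thesis by (rule tendsto_eventually)
        qed (auto simp: indicator_def)
      qed
    qed (use i in \<open>auto simp: indicator_def\<close>)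
    then show "(\<lambda>n. \<integral>x. max 0 (?i x - ?i (x + X n)) \<partial>lborel) \<longlonglongrightarrow> 0" by simp
  qed
  then have "((\<lambda>h. 2 * (\<integral>x. max 0 (?i x - ?i (x + h)) \<partial>lborel)) \<longlongrightarrow> 2 * 0) (at 0)"
    by (intro tendsto_intros)
  then show ?thesis unfolding L1_translation_continuous_def eq by simp
qed

text \<open>Induction over integrable functions: indicators of measurable sets are approximated in
  L1 by indicators of open supersets, sums follow from the triangle inequality, and limits of simple
  functions from dominated convergence.\<close>

lemma L1_translation_continuous:
  assumes "integrable lborel f"
  shows "L1_translation_continuous f"
  using assms
proof (induct rule: integrable_induct)
  case (base A c)
  have [measurable]: "A \<in> sets borel" using base by simp
  have iA: "integrable lborel (indicator A :: real \<Rightarrow> real)" using base by simp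
  have "L1_translation_continuous (indicator A)"
  proof (rule L1_translation_continuous_approx[OF iA])
    fix \<epsilon> :: real assume \<epsilon>: "\<epsilon> > 0"
    obtain S where S: "open S" "A \<subseteq> S" "emeasure lborel (S - A) < ennreal \<epsilon>"
      using outer_regular_lborel[of A \<epsilon>] \<epsilon> by auto
    have [measurable]: "S \<in> sets borel" using S by simp
    have "emeasure lborel S \<le> emeasure lborel A + emeasure lborel (S - A)"
      by (subst plus_emeasure) (use S in \<open>auto simp: Un_absorb1\<close>)
    also have "\<dots> < \<infinity>"
      using base S(3) less_trans[OF S(3) ennreal_less_top] by (simp add: less_top)
    finally have fS: "emeasure lborel S < \<infinity>" .
    have "(\<lambda>x. \<bar>indicator A x - indicator S x :: real\<bar>) = indicator (S - A)"
      using S(2) by (auto simp: indicator_def fun_eq_iff)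
    then have "(\<integral>x. \<bar>indicator A x - indicator S x\<bar> \<partial>lborel) = measure lborel (S - A)" by simp
    also have "\<dots> < \<epsilon>"
      using S(3) less_trans[OF S(3) ennreal_less_top] \<epsilon> by (simp add: emeasure_eq_ennreal_measure less_top ennreal_less_iff)
    finally show "\<exists>g. integrable lborel g \<and> L1_translation_continuous g \<and> (\<integral>x. \<bar>indicator A x - g x\<bar> \<partial>lborel) < \<epsilon>"
      using L1_translation_continuous_open[OF S(1) fS] fS by (intro exI[of _ "indicator S"]) auto
  qed
  then have "((\<lambda>h. \<bar>c\<bar> * (\<integral>x. \<bar>indicator A (x + h) - indicator A x\<bar> \<partial>lborel)) \<longlongrightarrow> \<bar>c\<bar> * 0) (at 0)"
    unfolding L1_translation_continuous_def by (intro tendsto_intros)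
  moreover have "\<bar>indicator A (x + h) *\<^sub>R c - indicator A x *\<^sub>R c\<bar> = \<bar>c\<bar> * \<bar>indicator A (x + h) - indicator A x :: real\<bar>" for x h
    by (simp add: abs_mult flip: left_diff_distrib)
  ultimately show ?case unfolding L1_translation_continuous_def by simp
next
  case (add f g)
  note i = integrable_abs Bochner_Integration.integrable_diff Bochner_Integration.integrable_add add(1,3)
    integrable_translate[OF add(1)] integrable_translate[OF add(3)]
  show ?case unfolding L1_translation_continuous_def
  proof (rule tendsto_sandwich[OF _ _ tendsto_const])
    show "((\<lambda>h. (\<integral>x. \<bar>f (x + h) - f x\<bar> \<partial>lborel) + (\<integral>x. \<bar>g (x + h) - g x\<bar> \<partial>lborel)) \<longlongrightarrow> 0) (at 0)"
      using tendsto_add[OF add(2,4)[unfolded L1_translation_continuous_def]] by simp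
    show "\<forall>\<^sub>F h in at 0. (\<integral>x. \<bar>f (x + h) + g (x + h) - (f x + g x)\<bar> \<partial>lborel)
       \<le> (\<integral>x. \<bar>f (x + h) - f x\<bar> \<partial>lborel) + (\<integral>x. \<bar>g (x + h) - g x\<bar> \<partial>lborel)"
    proof (intro always_eventually allI)
      fix h
      have "(\<integral>x. \<bar>f (x + h) + g (x + h) - (f x + g x)\<bar> \<partial>lborel) \<le> (\<integral>x. \<bar>f (x + h) - f x\<bar> + \<bar>g (x + h) - g x\<bar> \<partial>lborel)"
        by (rule integral_mono) ((intro i)+, linarith)
      also have "\<dots> = (\<integral>x. \<bar>f (x + h) - f x\<bar> \<partial>lborel) + (\<integral>x. \<bar>g (x + h) - g x\<bar> \<partial>lborel)"
        by (rule Bochner_Integration.integral_add) (intro i)+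
      finally show "(\<integral>x. \<bar>f (x + h) + g (x + h) - (f x + g x)\<bar> \<partial>lborel)
       \<le> (\<integral>x. \<bar>f (x + h) - f x\<bar> \<partial>lborel) + (\<integral>x. \<bar>g (x + h) - g x\<bar> \<partial>lborel)" .
    qed
  qed auto
next
  case (lim f s)
  show ?case
  proof (rule L1_translation_continuous_approx[OF lim(5)])
    fix \<epsilon> :: real assume \<epsilon>: "\<epsilon> > 0"
    have [measurable]: "f \<in> borel_measurable lborel" "\<And>i. s i \<in> borel_measurable lborel"
      using lim by auto
    have "(\<lambda>i. \<integral>x. \<bar>f x - s i x\<bar> \<partial>lborel) \<longlonglongrightarrow> (\<integral>x. 0 \<partial>(lborel::real measure))"
    \<comment> \<open>The induction rule provides
      \<open>\<bar>s i x\<bar> \<le> 2 * \<bar>f x\<bar>\<close>, which explains the factor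
      3.\<close>
    proof (rule integral_dominated_convergence[where w = "\<lambda>x. 3 * \<bar>f x\<bar>"])
      show "AE x in lborel. (\<lambda>i. \<bar>f x - s i x\<bar>) \<longlonglongrightarrow> 0"
      proof (intro AE_I2)
        fix x :: real
        have "(\<lambda>i. \<bar>f x - s i x\<bar>) \<longlonglongrightarrow> \<bar>f x - f x\<bar>" using lim(3)[of x] by (intro tendsto_intros) auto
        then show "(\<lambda>i. \<bar>f x - s i x\<bar>) \<longlonglongrightarrow> 0" by simp
      qed
      show "AE x in lborel. norm \<bar>f x - s i x\<bar> \<le> 3 * \<bar>f x\<bar>" for i
      proof (intro AE_I2)
        fix x :: real
        show "norm \<bar>f x - s i x\<bar> \<le> 3 * \<bar>f x\<bar>" using lim(4)[of x i] by simp
      qed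
    qed (use lim(5) in auto)
    then have "(\<lambda>i. \<integral>x. \<bar>f x - s i x\<bar> \<partial>lborel) \<longlonglongrightarrow> 0" by simp
    from order_tendstoD(2)[OF this \<epsilon>] obtain i where "(\<integral>x. \<bar>f x - s i x\<bar> \<partial>lborel) < \<epsilon>"
      by (meson eventually_happens' sequentially_bot)
    then show "\<exists>g. integrable lborel g \<and> L1_translation_continuous g \<and> (\<integral>x. \<bar>f x - g x\<bar> \<partial>lborel) < \<epsilon>"
      using lim(1,2) by blast
  qed
qed

subsection \<open>Square integrable limits\<close>

lemma integrable_le_nn_integral:
  fixes f :: "'b \<Rightarrow> real"
  assumes "f \<in> borel_measurable M" "\<And>x. 0 \<le> f x" "(\<integral>\<^sup>+x. ennreal (f x) \<partial>M) \<le> ennreal c" "c \<ge> 0"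
  shows "integrable M f" "integral\<^sup>L M f \<le> c"
proof -
  show i: "integrable M f"
    by (rule integrableI_nonneg) (use assms(1,2) le_less_trans[OF assms(3) ennreal_less_top] in auto)
  show "integral\<^sup>L M f \<le> c"
    using assms(3,4) nn_integral_eq_integral[OF i] assms(2) by (simp add: integral_nonneg_AE)
qed

text \<open>Used for the approximations themselves and for their differences from a fixed member of
  the sequence. The latter are controlled only for later indices, so the bound is assumed only
  eventually.\<close>

lemma Fatou_norm_sq:
  fixes f :: "nat \<Rightarrow> 'b \<Rightarrow> 'a::{banach,second_countable_topology}"
  assumes m: "\<And>n. f n \<in> borel_measurable M" "F \<in> borel_measurable M"
    and lim: "AE x in M. (\<lambda>n. f n x) \<longlonglongrightarrow> F x"
    and b: "\<forall>\<^sub>F n in sequentially. integrable M (\<lambda>x. (norm (f n x))\<^sup>2) \<and> (\<integral>x. (norm (f n x))\<^sup>2 \<partial>M) \<le> c" and c: "c \<ge> 0"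
  shows "integrable M (\<lambda>x. (norm (F x))\<^sup>2)" "(\<integral>x. (norm (F x))\<^sup>2 \<partial>M) \<le> c"
proof -
  have "(\<integral>\<^sup>+x. ennreal ((norm (F x))\<^sup>2) \<partial>M) = (\<integral>\<^sup>+x. liminf (\<lambda>n. ennreal ((norm (f n x))\<^sup>2)) \<partial>M)"
  proof (rule nn_integral_cong_AE)
    show "AE x in M. ennreal ((norm (F x))\<^sup>2) = liminf (\<lambda>n. ennreal ((norm (f n x))\<^sup>2))"
      using lim
    proof eventually_elim
      case (elim x)
      have "(\<lambda>n. ennreal ((norm (f n x))\<^sup>2)) \<longlonglongrightarrow> ennreal ((norm (F x))\<^sup>2)"
        by (intro tendsto_ennrealI tendsto_power tendsto_norm elim)
      then show ?case using lim_imp_Liminf[OF sequentially_bot] by metis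
    qed
  qed
  also have "\<dots> \<le> liminf (\<lambda>n. \<integral>\<^sup>+x. ennreal ((norm (f n x))\<^sup>2) \<partial>M)"
    by (rule nn_integral_liminf) (use m in measurable)
  also have "\<dots> \<le> limsup (\<lambda>n. \<integral>\<^sup>+x. ennreal ((norm (f n x))\<^sup>2) \<partial>M)"
    by (rule Liminf_le_Limsup) simp
  also have "\<dots> \<le> ennreal c"
  proof (rule Limsup_bounded)
    show "\<forall>\<^sub>F n in sequentially. (\<integral>\<^sup>+x. ennreal ((norm (f n x))\<^sup>2) \<partial>M) \<le> ennreal c"
      using b by eventually_elim (simp add: nn_integral_eq_integral ennreal_leI)
  qed
  finally have fin: "(\<integral>\<^sup>+x. ennreal ((norm (F x))\<^sup>2) \<partial>M) \<le> ennreal c" .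
  have mF: "(\<lambda>x. (norm (F x))\<^sup>2) \<in> borel_measurable M" using m(2) by measurable
  show "integrable M (\<lambda>x. (norm (F x))\<^sup>2)" "(\<integral>x. (norm (F x))\<^sup>2 \<partial>M) \<le> c"
    using integrable_le_nn_integral[OF mF _ fin c] by auto
qed

text \<open>Takes the place of Minkowski's inequality at the price of a factor 2, so that the L2
  estimates below can stay with squared norms.\<close>

lemma norm_diff_sq_le:
  fixes a b :: "'a::real_normed_vector"
  shows "(norm (a - b))\<^sup>2 \<le> 2 * (norm a)\<^sup>2 + 2 * (norm b)\<^sup>2"
proof -
  have "(norm (a - b))\<^sup>2 \<le> (norm a + norm b)\<^sup>2" by (intro power_mono norm_triangle_ineq4) simp
  also have "\<dots> \<le> 2 * (norm a)\<^sup>2 + 2 * (norm b)\<^sup>2"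
    using sum_squares_bound[of "norm a" "norm b"] by (simp add: power2_sum)
  finally show ?thesis .
qed

lemma norm_sq_diff_integrable:
  fixes f g :: "'b \<Rightarrow> 'a::{banach,second_countable_topology}"
  assumes m[measurable]: "f \<in> borel_measurable M" "g \<in> borel_measurable M"
    and i: "integrable M (\<lambda>x. (norm (f x))\<^sup>2)" "integrable M (\<lambda>x. (norm (g x))\<^sup>2)"
  shows "integrable M (\<lambda>x. (norm (f x - g x))\<^sup>2)"
    "(\<integral>x. (norm (f x - g x))\<^sup>2 \<partial>M) \<le> 2 * (\<integral>x. (norm (f x))\<^sup>2 \<partial>M) + 2 * (\<integral>x. (norm (g x))\<^sup>2 \<partial>M)"
proof -
  have ib: "integrable M (\<lambda>x. 2 * (norm (f x))\<^sup>2 + 2 * (norm (g x))\<^sup>2)" using i by simp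
  show id: "integrable M (\<lambda>x. (norm (f x - g x))\<^sup>2)"
    by (rule Bochner_Integration.integrable_bound[OF ib]) (use norm_diff_sq_le in auto)
  have "(\<integral>x. (norm (f x - g x))\<^sup>2 \<partial>M) \<le> (\<integral>x. 2 * (norm (f x))\<^sup>2 + 2 * (norm (g x))\<^sup>2 \<partial>M)"
    by (intro integral_mono id ib norm_diff_sq_le)
  then show "(\<integral>x. (norm (f x - g x))\<^sup>2 \<partial>M) \<le> 2 * (\<integral>x. (norm (f x))\<^sup>2 \<partial>M) + 2 * (\<integral>x. (norm (g x))\<^sup>2 \<partial>M)"
    using i by simp
qed

text \<open>Either d is at most (1/2)^n, or 2^n d exceeds 1 and d can be multiplied by it. This
  trades a first power for a square, with a remainder that is summable in n; it is used where
  Cauchy-Schwarz would be expected.\<close>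

lemma le_weighted_square:
  fixes d :: real
  shows "d \<le> 2 ^ n * d\<^sup>2 + (1/2) ^ n"
proof (cases "d \<le> (1/2) ^ n")
  case True
  have "0 \<le> 2 ^ n * d\<^sup>2" by simp
  then show ?thesis using True by linarith
next
  case False
  then have d: "d > (1/2) ^ n" by simp
  then have d0: "d > 0" using zero_less_power[of "1/2::real" n] by linarith
  have "1 \<le> 2 ^ n * d" using d by (simp add: power_one_over field_simps)
  then have "1 * d \<le> 2 ^ n * d * d" using d0 by (intro mult_right_mono) auto
  then show ?thesis by (simp add: power2_eq_square mult.assoc add_increasing2)
qed

text \<open>Weighting the squared increments by 2^n leaves integrals of size c (1/4)^n, so the
  weighted squares are summable almost everywhere. By \<open>le_weighted_square\<close> the
  increments are then absolutely summable, and the sequence telescopes to a convergent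
  series.\<close>

lemma AE_convergent_if_rapidly_Cauchy:
  fixes f :: "nat \<Rightarrow> 'b \<Rightarrow> 'a::{banach,second_countable_topology}"
  assumes m[measurable]: "\<And>n. f n \<in> borel_measurable M"
    and i: "\<And>n. integrable M (\<lambda>x. (norm (f (Suc n) x - f n x))\<^sup>2)"
    and b: "\<And>n. (\<integral>x. (norm (f (Suc n) x - f n x))\<^sup>2 \<partial>M) \<le> c * (1/8) ^ n" and c: "c \<ge> 0"
  shows "AE x in M. convergent (\<lambda>n. f n x)"
proof -
  define q where "q n x = 2 ^ n * (norm (f (Suc n) x - f n x))\<^sup>2" for n x
  have mq[measurable]: "q n \<in> borel_measurable M" for n unfolding q_def by measurable
  have q0: "q n x \<ge> 0" for n x unfolding q_def by simp
  have qi: "integrable M (q n)" for n unfolding q_def using i by simp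
  have "(\<integral>\<^sup>+x. (\<Sum>n. ennreal (q n x)) \<partial>M) = (\<Sum>n. \<integral>\<^sup>+x. ennreal (q n x) \<partial>M)"
    by (rule nn_integral_suminf) measurable
  also have "\<dots> \<le> (\<Sum>n. ennreal (c * (1/4) ^ n))"
  proof (rule suminf_le)
    fix n
    have "integral\<^sup>L M (q n) \<le> 2 ^ n * (c * (1/8) ^ n)" unfolding q_def using b[of n] by simp
    also have "\<dots> = c * ((2 * (1/8)) ^ n)" unfolding power_mult_distrib by (rule mult.left_commute)
    finally have "integral\<^sup>L M (q n) \<le> c * (1/4) ^ n" by simp
    then show "(\<integral>\<^sup>+x. ennreal (q n x) \<partial>M) \<le> ennreal (c * (1/4) ^ n)"
      using nn_integral_eq_integral[OF qi] q0 by (simp add: ennreal_leI)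
  qed auto
  also have "\<dots> = ennreal (\<Sum>n. c * (1/4) ^ n)"
    using c by (intro suminf_ennreal2 summable_mult summable_geometric) auto
  finally have "(\<integral>\<^sup>+x. (\<Sum>n. ennreal (q n x)) \<partial>M) < \<infinity>"
    using ennreal_less_top le_less_trans by (metis infinity_ennreal_def)
  then have "AE x in M. (\<Sum>n. ennreal (q n x)) \<noteq> \<infinity>"
    by (intro nn_integral_PInf_AE) auto
  then show ?thesis
  proof eventually_elim
    case (elim x)
    have sq: "summable (\<lambda>n. q n x)"
      using elim q0 by (intro summable_suminf_not_top) (auto simp: infinity_ennreal_def)
    have "summable (\<lambda>n. norm (f (Suc n) x - f n x))"
    proof (rule summable_comparison_test'[where N = 0])
      show "summable (\<lambda>n. q n x + (1/2) ^ n)"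
        by (intro summable_add sq summable_geometric) simp
      show "norm (norm (f (Suc n) x - f n x)) \<le> q n x + (1/2) ^ n" for n
        unfolding q_def real_norm_def abs_norm_cancel by (rule le_weighted_square)
    qed
    then have s: "summable (\<lambda>n. f (Suc n) x - f n x)" by (rule summable_norm_cancel)
    have eq: "(\<lambda>n. f n x) = (\<lambda>n. f 0 x + (\<Sum>k<n. f (Suc k) x - f k x))"
      using sum_lessThan_telescope[of "\<lambda>n. f n x"] by (simp add: fun_eq_iff)
    show ?case
      by (subst eq) (intro convergent_add convergent_const summable_iff_convergent[THEN iffD1] s)
  qed
qed

subsection \<open>Systems in characteristic form\<close>

text \<open>\<open>E\<close> is an orthonormal eigenbasis of \<open>A\<close> with eigenvalues \<open>lam\<close>; \<open>B x\<close> is the matrix \<open>Q / \<epsilon>(x)\<close>.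
  Points of \<open>real \<times> real\<close> are pairs \<open>(x, t)\<close>.\<close>

locale characteristic_system =
  fixes E :: "'a::euclidean_space set" and lam :: "'a \<Rightarrow> real" and B :: "real \<Rightarrow> 'a \<Rightarrow> 'a" and C L :: real
  assumes finE: "finite E"
    and orth: "\<And>e e'. e \<in> E \<Longrightarrow> e' \<in> E \<Longrightarrow> e \<bullet> e' = (if e = e' then 1 else 0)"
    and expand: "\<And>v. (\<Sum>e\<in>E. (e \<bullet> v) *\<^sub>R e) = v"
    and lam_bound: "\<And>e. e \<in> E \<Longrightarrow> \<bar>lam e\<bar> \<le> L"
    and L_nonneg: "L \<ge> 0" and C_nonneg: "C \<ge> 0"
    and linear_B: "\<And>x. linear (B x)"
    and norm_B: "\<And>x v. norm (B x v) \<le> C * norm v"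
    and measurable_B: "(\<lambda>z. B (fst z) (snd z)) \<in> borel_measurable borel"
    and dissipative: "\<And>x v. v \<bullet> B x v \<le> 0"
begin

section \<open>Coordinates in the eigenbasis\<close>

lemma borel_measurable_B:
  assumes "f \<in> borel_measurable M" "g \<in> borel_measurable M"
  shows "(\<lambda>x. B (f x) (g x)) \<in> borel_measurable M"
  using borel_measurable_compose_Pair[OF measurable_B assms] by simp

lemma norm_basis: "e \<in> E \<Longrightarrow> norm e = 1"
  using orth[of e e] by (simp add: norm_eq_1)

lemma inner_basis_le: "e \<in> E \<Longrightarrow> \<bar>e \<bullet> v\<bar> \<le> norm v"
  using Cauchy_Schwarz_ineq2[of e v] norm_basis by simp

lemma inner_expand: "v \<bullet> w = (\<Sum>e\<in>E. (e \<bullet> v) * (e \<bullet> w))"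
  by (subst expand[of v, symmetric]) (simp add: inner_sum_left)

lemma norm_expand: "(norm v)\<^sup>2 = (\<Sum>e\<in>E. (e \<bullet> v)\<^sup>2)"
  by (subst power2_norm_eq_inner, subst inner_expand) (simp add: power2_eq_square)

lemma inner_basis_sum: "e \<in> E \<Longrightarrow> e \<bullet> (\<Sum>e'\<in>E. c e' *\<^sub>R e') = c e"
proof -
  assume e: "e \<in> E"
  have "e \<bullet> (\<Sum>e'\<in>E. c e' *\<^sub>R e') = (\<Sum>e'\<in>E. if e = e' then c e' else 0)"
    unfolding inner_sum_right using e orth by (intro sum.cong) auto
  then show ?thesis using e finE by simp
qed

lemma norm_basis_sum_le: "norm (\<Sum>e\<in>E. c e *\<^sub>R e) \<le> (\<Sum>e\<in>E. \<bar>c e\<bar>)"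
  by (rule order_trans[OF norm_sum]) (simp add: norm_basis)

section \<open>Mild solutions and their linearity\<close>

text \<open>The rate of change at time s of the component along \<open>e\<close>, on its
  characteristic with foot y at time 0.\<close>

definition source :: "'a \<Rightarrow> (real \<times> real \<Rightarrow> 'a) \<Rightarrow> real \<Rightarrow> real \<Rightarrow> real" where
  "source e w y s = e \<bullet> B (y + lam e * s) (w (y + lam e * s, s))"

text \<open>The system integrated along its characteristics, for bounded solutions with finite propagation speed.\<close>

definition mild :: "(real \<times> real \<Rightarrow> 'a) \<Rightarrow> bool" where
  "mild w \<longleftrightarrow> w \<in> borel_measurable borel \<and>
     (\<forall>T. \<exists>M. \<forall>x t. 0 \<le> t \<and> t \<le> T \<longrightarrow> norm (w (x, t)) \<le> M) \<and>
     (\<exists>R. \<forall>x t. 0 \<le> t \<and> \<bar>x\<bar> > R + L * t \<longrightarrow> w (x, t) = 0) \<and>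
     (\<forall>e\<in>E. \<forall>y. \<forall>t\<ge>0. e \<bullet> w (y + lam e * t, t) =
        e \<bullet> w (y, 0) + (\<integral>s. indicator {0..t} s * source e w y s \<partial>lborel))"

lemma source_le: "e \<in> E \<Longrightarrow> \<bar>source e w y s\<bar> \<le> C * norm (w (y + lam e * s, s))"
  unfolding source_def by (rule order_trans[OF inner_basis_le norm_B])

lemma borel_measurable_source:
  assumes "w \<in> borel_measurable borel" "f \<in> borel_measurable M" "g \<in> borel_measurable M"
  shows "(\<lambda>x. source e w (f x) (g x)) \<in> borel_measurable M"
  unfolding source_def
  by (intro borel_measurable_inner borel_measurable_const borel_measurable_B
      borel_measurable_compose_Pair[OF assms(1)] borel_measurable_add borel_measurable_times assms(2,3))

lemma integrable_source:
  assumes w: "w \<in> borel_measurable borel" and e: "e \<in> E"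
    and b: "\<And>x s. 0 \<le> s \<Longrightarrow> s \<le> t \<Longrightarrow> norm (w (x, s)) \<le> M"
  shows "integrable lborel (\<lambda>s. indicator {0..t} s * source e w y s)"
proof -
  have b': "norm (source e w y s) \<le> C * M" if "s \<in> {0..t}" for s
  proof -
    have "norm (w (y + lam e * s, s)) \<le> M" using that by (intro b) auto
    then have "C * norm (w (y + lam e * s, s)) \<le> C * M" by (intro mult_left_mono C_nonneg)
    then show ?thesis using source_le[OF e, of w y s] unfolding real_norm_def by (rule order_trans[rotated])
  qed
  have "(\<lambda>s. source e w y s) \<in> borel_measurable borel"
    by (intro borel_measurable_source[OF w] borel_measurable_const measurable_ident_sets[OF refl])
  moreover have "{0..t} \<in> sets borel" "bounded {0..t}" by auto
  ultimately have "integrable lborel (\<lambda>s. indicator {0..t} s *\<^sub>R source e w y s)"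
    by (rule integrable_bounded_indicator) (rule b')
  then show ?thesis unfolding real_scaleR_def .
qed

lemma mild_bound:
  fixes T :: real
  assumes "mild w" obtains M where "M \<ge> 0" "\<And>x t. 0 \<le> t \<Longrightarrow> t \<le> T \<Longrightarrow> norm (w (x, t)) \<le> M"
proof -
  from assms have "\<forall>T. \<exists>M. \<forall>x t. 0 \<le> t \<and> t \<le> T \<longrightarrow> norm (w (x, t)) \<le> M"
    unfolding mild_def by (elim conjE)
  then obtain M where M: "\<And>x t. 0 \<le> t \<and> t \<le> T \<Longrightarrow> norm (w (x, t)) \<le> M" by blast
  show ?thesis by (rule that[of "max M 0"]) (simp_all add: max.coboundedI1 M)
qed

lemma mild_support:
  assumes "mild w" obtains R where "R \<ge> 0" "\<And>x t. 0 \<le> t \<Longrightarrow> \<bar>x\<bar> > R + L * t \<Longrightarrow> w (x, t) = 0"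
proof -
  from assms have "\<exists>R. \<forall>x t. 0 \<le> t \<and> \<bar>x\<bar> > R + L * t \<longrightarrow> w (x, t) = 0"
    unfolding mild_def by (elim conjE)
  then obtain R where R: "\<And>x t. 0 \<le> t \<and> \<bar>x\<bar> > R + L * t \<Longrightarrow> w (x, t) = 0" by blast
  show ?thesis by (rule that[of "max R 0"]) (auto intro!: R)
qed

lemma mild_measurable: "mild w \<Longrightarrow> w \<in> borel_measurable borel"
  unfolding mild_def by simp

lemma mild_eq: "mild w \<Longrightarrow> e \<in> E \<Longrightarrow> t \<ge> 0 \<Longrightarrow>
    e \<bullet> w (y + lam e * t, t) = e \<bullet> w (y, 0) + (\<integral>s. indicator {0..t} s * source e w y s \<partial>lborel)"
  unfolding mild_def by blast

lemma source_diff: "source e (\<lambda>z. v z - w z) y s = source e v y s - source e w y s"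
  unfolding source_def by (simp add: linear_diff[OF linear_B] inner_diff_right)

lemma mild_diff:
  assumes v: "mild v" and w: "mild w"
  shows "mild (\<lambda>z. v z - w z)"
  unfolding mild_def
proof (intro conjI ballI allI impI)
  show "(\<lambda>z. v z - w z) \<in> borel_measurable borel"
    by (intro borel_measurable_diff mild_measurable v w)
  fix T :: real
  obtain M where "M \<ge> 0" and M: "\<And>x t. 0 \<le> t \<Longrightarrow> t \<le> T \<Longrightarrow> norm (v (x, t)) \<le> M" using mild_bound[OF v, of T] by blast
  obtain N where "N \<ge> 0" and N: "\<And>x t. 0 \<le> t \<Longrightarrow> t \<le> T \<Longrightarrow> norm (w (x, t)) \<le> N" using mild_bound[OF w, of T] by blast
  show "\<exists>K. \<forall>x t. 0 \<le> t \<and> t \<le> T \<longrightarrow> norm (v (x, t) - w (x, t)) \<le> K"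
    by (intro exI[of _ "M + N"] allI impI norm_triangle_le_diff add_mono M N) simp_all
next
  obtain R where "R \<ge> 0" and R: "\<And>x t. 0 \<le> t \<Longrightarrow> \<bar>x\<bar> > R + L * t \<Longrightarrow> v (x, t) = 0" using mild_support[OF v] by blast
  obtain S where "S \<ge> 0" and S: "\<And>x t. 0 \<le> t \<Longrightarrow> \<bar>x\<bar> > S + L * t \<Longrightarrow> w (x, t) = 0" using mild_support[OF w] by blast
  show "\<exists>R. \<forall>x t. 0 \<le> t \<and> \<bar>x\<bar> > R + L * t \<longrightarrow> v (x, t) - w (x, t) = 0"
  proof (intro exI allI impI)
    fix x t :: real assume a: "0 \<le> t \<and> \<bar>x\<bar> > max R S + L * t"
    then have "\<bar>x\<bar> > R + L * t" "\<bar>x\<bar> > S + L * t" by linarith+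
    then show "v (x, t) - w (x, t) = 0" using R[of t x] S[of t x] a by simp
  qed
next
  fix e y and t :: real assume e: "e \<in> E" and t: "t \<ge> 0"
  obtain M where "M \<ge> 0" and M: "\<And>x s. 0 \<le> s \<Longrightarrow> s \<le> t \<Longrightarrow> norm (v (x, s)) \<le> M" using mild_bound[OF v, of t] by blast
  obtain N where "N \<ge> 0" and N: "\<And>x s. 0 \<le> s \<Longrightarrow> s \<le> t \<Longrightarrow> norm (w (x, s)) \<le> N" using mild_bound[OF w, of t] by blast
  show "e \<bullet> (v (y + lam e * t, t) - w (y + lam e * t, t)) = e \<bullet> (v (y, 0) - w (y, 0))
      + (\<integral>s. indicator {0..t} s * source e (\<lambda>z. v z - w z) y s \<partial>lborel)"
  proof -
    have "(\<integral>s. indicator {0..t} s * source e (\<lambda>z. v z - w z) y s \<partial>lborel)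
        = (\<integral>s. indicator {0..t} s * source e v y s \<partial>lborel) - (\<integral>s. indicator {0..t} s * source e w y s \<partial>lborel)"
      unfolding source_diff right_diff_distrib
      by (intro Bochner_Integration.integral_diff integrable_source[OF mild_measurable[OF v] e M]
          integrable_source[OF mild_measurable[OF w] e N])
    then show ?thesis using mild_eq[OF v e t, of y] mild_eq[OF w e t, of y]
      unfolding inner_diff_right by linarith
  qed
qed

text \<open>Picard iteration: the Dyson series of the perturbation \<open>B\<close> of the free transport.\<close>

definition free_flow :: "(real \<Rightarrow> 'a) \<Rightarrow> real \<times> real \<Rightarrow> 'a" where
  "free_flow u z = (\<Sum>e\<in>E. (e \<bullet> u (fst z - lam e * snd z)) *\<^sub>R e)"

text \<open>The response to the source of \<open>w\<close> with zero initial data. The point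
  \<open>fst z - lam e * snd z\<close> is the foot of the characteristic of \<open>e\<close> through
  z.\<close>

definition duhamel :: "(real \<times> real \<Rightarrow> 'a) \<Rightarrow> real \<times> real \<Rightarrow> 'a" where
  "duhamel w z = (\<Sum>e\<in>E. (\<integral>s. indicator {0..snd z} s * source e w (fst z - lam e * snd z) s \<partial>lborel) *\<^sub>R e)"

text \<open>The members of this sequence are the terms of the series, not its partial sums.\<close>

primrec dyson :: "(real \<Rightarrow> 'a) \<Rightarrow> nat \<Rightarrow> real \<times> real \<Rightarrow> 'a" where
  "dyson u 0 = free_flow u"
| "dyson u (Suc k) = duhamel (dyson u k)"

lemma borel_measurable_duhamel:
  assumes "w \<in> borel_measurable borel" shows "duhamel w \<in> borel_measurable borel"
proof -
  have "(\<lambda>z. \<integral>s. indicator {0..snd z} s * source e w (fst z - lam e * snd z) s \<partial>lborel)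
      \<in> borel_measurable (borel \<Otimes>\<^sub>M borel)" for e
  proof (rule lborel.borel_measurable_lebesgue_integral)
    have 1: "(\<lambda>x. fst (fst x) - lam e * snd (fst x)) \<in> borel_measurable ((borel \<Otimes>\<^sub>M borel) \<Otimes>\<^sub>M lborel)"
      and 2: "snd \<in> borel_measurable ((borel \<Otimes>\<^sub>M borel) \<Otimes>\<^sub>M (lborel :: real measure))"
      and 3: "(\<lambda>x. snd (fst x)) \<in> borel_measurable ((borel \<Otimes>\<^sub>M (borel::real measure)) \<Otimes>\<^sub>M (lborel :: real measure))"
      by measurable
    show "(\<lambda>(z, s). indicator {0..snd z} s * source e w (fst z - lam e * snd z) s)
        \<in> borel_measurable ((borel \<Otimes>\<^sub>M borel) \<Otimes>\<^sub>M lborel)"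
      unfolding case_prod_beta
      by (intro borel_measurable_times borel_measurable_indicator_Icc borel_measurable_source[OF assms] 1 2 3
          borel_measurable_const)
  qed
  then show ?thesis unfolding duhamel_def[abs_def] borel_prod
    by (intro borel_measurable_sum borel_measurable_scaleR borel_measurable_const)
qed

lemma borel_measurable_dyson:
  assumes u: "u \<in> borel_measurable borel" shows "dyson u k \<in> borel_measurable borel"
proof (induction k)
  case 0
  have "(\<lambda>z. u (fst z - lam e * snd z)) \<in> borel_measurable borel" for e
    by (rule measurable_compose[OF _ u]) (intro borel_measurable_continuous_onI continuous_intros)
  then show ?case unfolding dyson.simps free_flow_def[abs_def]
    by (intro borel_measurable_sum borel_measurable_scaleR borel_measurable_const borel_measurable_inner)
qed (simp add: borel_measurable_duhamel)

text \<open>One application of \<open>duhamel\<close> multiplies by \<open>card E * C\<close> and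
  integrates s^k over [0, t], which produces the next factor of the factorial. The factor
  \<open>card E\<close> comes from estimating a norm by the sum of its coordinates.\<close>

lemma dyson_bound:
  fixes M :: real
  assumes M: "\<And>x. norm (u x) \<le> M" and "t \<ge> 0"
  shows "norm (dyson u k (x, t)) \<le> card E * M * ((card E * C * t) ^ k / fact k)"
  using \<open>t \<ge> 0\<close>
proof (induction k arbitrary: x t)
  case 0
  have "norm (dyson u 0 (x, t)) \<le> (\<Sum>e\<in>E. \<bar>e \<bullet> u (x - lam e * t)\<bar>)"
    using norm_basis_sum_le[of "\<lambda>e. e \<bullet> u (x - lam e * t)"] by (simp add: free_flow_def)
  also have "\<dots> \<le> (\<Sum>e\<in>E. M)"
    by (intro sum_mono) (meson inner_basis_le M order_trans)
  finally show ?case by simp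
next
  case (Suc k)
  have M0: "M \<ge> 0" using M[of 0] norm_ge_zero order_trans by blast
  define K where "K = card E * C"
  have K0: "K \<ge> 0" unfolding K_def using C_nonneg by simp
  define N where "N = C * (card E * M * (K ^ k / fact k))"
  have N0: "N \<ge> 0" unfolding N_def using C_nonneg M0 K0 by simp
  have "\<bar>\<integral>s. indicator {0..t} s * source e (dyson u k) y s \<partial>lborel\<bar> \<le> N * (t ^ Suc k / Suc k)" if e: "e \<in> E" for e y
  proof -
    have "\<bar>\<integral>s. indicator {0..t} s * source e (dyson u k) y s \<partial>lborel\<bar>
        \<le> (\<integral>s. \<bar>indicator {0..t} s * source e (dyson u k) y s\<bar> \<partial>lborel)"
      using integral_norm_bound[of lborel "\<lambda>s. indicator {0..t} s * source e (dyson u k) y s"] by simp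
    also have "\<dots> \<le> (\<integral>s. N * (s ^ k * indicator {0..t} s) \<partial>lborel)"
    proof (rule integral_mono')
      have "integrable lborel (\<lambda>s. indicator {0..t} s *\<^sub>R (s ^ k))"
        by (intro borel_integrable_compact) (auto intro!: continuous_intros)
      then show "integrable lborel (\<lambda>s. N * (s ^ k * indicator {0..t} s))" by (simp add: mult.commute)
      fix s :: real
      show "0 \<le> N * (s ^ k * indicator {0..t} s)" using N0 by (auto simp: indicator_def)
      show "\<bar>indicator {0..t} s * source e (dyson u k) y s\<bar> \<le> N * (s ^ k * indicator {0..t} s)"
      proof (cases "s \<in> {0..t}")
        case True
        have "\<bar>source e (dyson u k) y s\<bar> \<le> C * (card E * M * ((K * s) ^ k / fact k))"
          using source_le[OF e, of "dyson u k" y s] mult_left_mono[OF Suc.IH[of s "y + lam e * s"] C_nonneg] True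
          by (simp add: K_def)
        also have "\<dots> = N * s ^ k" unfolding N_def by (simp add: power_mult_distrib)
        finally show ?thesis using True by simp
      qed simp
    qed
    also have "\<dots> = N * (t ^ Suc k / Suc k)" using integral_power[of 0 t k] Suc.prems by simp
    finally show ?thesis .
  qed
  then have "norm (dyson u (Suc k) (x, t)) \<le> (\<Sum>e\<in>E. N * (t ^ Suc k / Suc k))"
    unfolding dyson.simps duhamel_def fst_conv snd_conv
    by (intro order_trans[OF norm_basis_sum_le] sum_mono) auto
  also have "\<dots> = card E * M * ((card E * C * t) ^ Suc k / fact (Suc k))"
  proof -
    have "a * (C * (a * M * (p / q)) * (r / s)) = a * M * ((a * C * p) * r / (s * q))" for a p q r s :: real
      by (simp add: divide_inverse ac_simps)
    from this[of "card E" "K ^ k" "fact k" "t ^ Suc k" "Suc k"] show ?thesis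
      unfolding N_def K_def[symmetric] by (simp add: power_mult_distrib del: of_nat_Suc)
  qed
  finally show ?case .
qed

text \<open>Propagation speed at most L: the characteristic through (x, t) is at time s still within
  L (t - s) of x, hence outside the region of radius R + L s where the previous term may
  live.\<close>

lemma dyson_support:
  assumes R: "\<And>x. \<bar>x\<bar> > R \<Longrightarrow> u x = 0" and "t \<ge> 0" "\<bar>x\<bar> > R + L * t"
  shows "dyson u k (x, t) = 0"
  using assms(2,3)
proof (induction k arbitrary: x t)
  case 0
  have "u (x - lam e * t) = 0" if e: "e \<in> E" for e
  proof (rule R)
    have "\<bar>lam e * t\<bar> \<le> L * t" using lam_bound[OF e] 0 by (simp add: abs_mult mult_right_mono)
    then show "R < \<bar>x - lam e * t\<bar>" using 0 by linarith
  qed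
  then show ?case by (simp add: free_flow_def)
next
  case (Suc k)
  have "indicator {0..t} s * source e (dyson u k) (x - lam e * t) s = 0" if e: "e \<in> E" for e s
  proof (cases "s \<in> {0..t}")
    case True
    have "dyson u k (x - lam e * t + lam e * s, s) = 0"
    proof (rule Suc.IH)
      have "\<bar>lam e * (t - s)\<bar> \<le> L * (t - s)" using lam_bound[OF e] True by (simp add: abs_mult mult_right_mono)
      then show "R + L * s < \<bar>x - lam e * t + lam e * s\<bar>" using Suc.prems True by (simp add: algebra_simps)
    qed (use True in auto)
    then show ?thesis by (simp add: source_def linear_0[OF linear_B])
  qed simp
  then have "(\<integral>s. indicator {0..t} s * source e (dyson u k) (x - lam e * t) s \<partial>lborel) = 0" if "e \<in> E" for e
    using that by (simp only: Bochner_Integration.integral_zero)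
  then show ?case by (simp add: duhamel_def)
qed

text \<open>The series is dominated by that of N exp(K t), hence converges absolutely and locally
  uniformly in time. Since \<open>duhamel\<close> shifts the index by one, summing the terms yields
  the integral equation once sum and integral are exchanged.\<close>

lemma mild_exists:
  fixes M :: real
  assumes u: "u \<in> borel_measurable borel" and M: "\<And>x. norm (u x) \<le> M" and R: "\<And>x. \<bar>x\<bar> > R \<Longrightarrow> u x = 0"
  shows "\<exists>w. mild w \<and> (\<forall>x. w (x, 0) = u x)"
proof -
  define w where "w z = (\<Sum>k. dyson u k z)" for z
  define K where "K = card E * C"
  define N where "N = card E * M"
  have K0: "K \<ge> 0" unfolding K_def using C_nonneg by simp
  have M0: "M \<ge> 0" using M[of 0] norm_ge_zero order_trans by blast
  have N0: "N \<ge> 0" unfolding N_def using M0 by simp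
  have bd: "norm (dyson u k (x, t)) \<le> N * ((K * t) ^ k / fact k)" if "t \<ge> 0" for x t k
    using dyson_bound[OF M that] by (simp add: N_def K_def)
  have es: "(\<lambda>k. N * ((K * t) ^ k / fact k)) sums (N * exp (K * t))" for t
    using sums_mult[OF exp_converges[of "K * t"], of N] by (simp add: divide_inverse mult.commute)
  have sn: "summable (\<lambda>k. norm (dyson u k (x, t)))" if "t \<ge> 0" for x t
    by (rule summable_comparison_test'[OF sums_summable[OF es[of t]], where N = 0]) (simp only: real_norm_def abs_norm_cancel bd[OF that])
  note s = summable_norm_cancel[OF sn]
  have wb: "norm (w (x, t)) \<le> N * exp (K * t)" if "t \<ge> 0" for x t
  proof -
    have "norm (w (x, t)) \<le> (\<Sum>k. norm (dyson u k (x, t)))"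
      unfolding w_def by (rule summable_norm[OF sn[OF that]])
    also have "\<dots> \<le> (\<Sum>k. N * ((K * t) ^ k / fact k))"
      by (rule suminf_le[OF bd[OF that] sn[OF that] sums_summable[OF es]])
    also have "\<dots> = N * exp (K * t)" by (rule sums_unique[OF es, symmetric])
    finally show ?thesis .
  qed
  \<comment> \<open>At time 0 the bound contains 0^k, so only the free term survives.\<close>
  have w0: "w (x, 0) = u x" for x
  proof -
    have "dyson u k (x, 0) = 0" if "k \<noteq> 0" for k using bd[of 0 k x] that by (simp add: power_0_left)
    then have "w (x, 0) = (\<Sum>k\<in>{0}. dyson u k (x, 0))"
      unfolding w_def by (intro suminf_finite) auto
    then show ?thesis by (simp add: free_flow_def expand)
  qed
  have "mild w" unfolding mild_def
  proof (intro conjI ballI allI impI)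
    show "w \<in> borel_measurable borel" unfolding w_def[abs_def]
      by (intro borel_measurable_suminf borel_measurable_dyson u)
    show "\<exists>M. \<forall>x t. 0 \<le> t \<and> t \<le> T \<longrightarrow> norm (w (x, t)) \<le> M" for T
    proof (intro exI allI impI)
      fix x t :: real assume t: "0 \<le> t \<and> t \<le> T"
      have "norm (w (x, t)) \<le> N * exp (K * t)" using wb t by simp
      also have "\<dots> \<le> N * exp (K * T)" using t K0 N0 by (intro mult_left_mono) (auto intro: mult_left_mono)
      finally show "norm (w (x, t)) \<le> N * exp (K * T)" .
    qed
    show "\<exists>R. \<forall>x t. 0 \<le> t \<and> \<bar>x\<bar> > R + L * t \<longrightarrow> w (x, t) = 0"
      using dyson_support[OF R] unfolding w_def by (intro exI[of _ R]) auto
    fix e y and t :: real assume e: "e \<in> E" and t: "t \<ge> 0"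
    define f where "f k s = indicator {0..t} s * source e (dyson u k) y s" for k and s :: real
    \<comment> \<open>Replacing s by t in the bound makes it constant on the interval, so one
      summable sequence controls both the pointwise series and the series of integrals.\<close>
    have fb: "\<bar>f k s\<bar> \<le> C * (N * ((K * t) ^ k / fact k)) * indicator {0..t} s" for k s
    proof (cases "s \<in> {0..t}")
      case True
      have "\<bar>source e (dyson u k) y s\<bar> \<le> C * (N * ((K * s) ^ k / fact k))"
        using source_le[OF e, of "dyson u k" y s] mult_left_mono[OF bd[of s k "y + lam e * s"] C_nonneg] True by simp
      also have "\<dots> \<le> C * (N * ((K * t) ^ k / fact k))"
        using True K0 N0 C_nonneg by (intro mult_left_mono divide_right_mono power_mono) auto
      finally show ?thesis using True by (simp add: f_def)
    qed (simp add: f_def)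
    have ds: "summable (\<lambda>k. C * (N * ((K * t) ^ k / fact k)))"
      by (intro summable_mult sums_summable[OF es])
    have fi: "integrable lborel (f k)" for k
    proof -
      have "norm (dyson u k (x, s)) \<le> N * ((K * t) ^ k / fact k)" if "0 \<le> s" "s \<le> t" for x s
        by (rule order_trans[OF bd[OF that(1)]])
          (use that K0 N0 in \<open>intro mult_left_mono divide_right_mono power_mono; auto\<close>)
      then show ?thesis unfolding f_def by (intro integrable_source[OF borel_measurable_dyson[OF u] e])
    qed
    have fs: "summable (\<lambda>k. norm (f k s))" for s
      by (rule summable_comparison_test'[OF summable_mult2[OF ds, of "indicator {0..t} s"], where N = 0]) (simp only: real_norm_def abs_abs fb)
    have fis: "summable (\<lambda>k. \<integral>s. norm (f k s) \<partial>lborel)"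
    proof (rule summable_comparison_test'[OF summable_mult2[OF ds, of t], where N = 0])
      fix k :: nat
      have "(\<integral>s. norm (f k s) \<partial>lborel) \<le> (\<integral>s. C * (N * ((K * t) ^ k / fact k)) * indicator {0..t} s \<partial>lborel)"
      proof (rule integral_mono)
        show "integrable lborel (\<lambda>s. norm (f k s))" using fi by (rule integrable_norm)
        have "integrable lborel (\<lambda>s. c * indicator {0..t} s)" for c :: real
          using integrable_bounded_indicator[of "\<lambda>_. c" "{0..t}" "\<bar>c\<bar>"] by (simp add: mult.commute)
        then show "integrable lborel (\<lambda>s. C * (N * ((K * t) ^ k / fact k)) * indicator {0..t} s)" .
      qed (simp only: real_norm_def fb)
      also have "\<dots> = C * (N * ((K * t) ^ k / fact k)) * t" using t by simp
      finally show "norm (\<integral>s. norm (f k s) \<partial>lborel) \<le> C * (N * ((K * t) ^ k / fact k)) * t"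
        by simp
    qed
    have src: "(\<Sum>k. f k s) = indicator {0..t} s * source e w y s" for s
    proof (cases "s \<in> {0..t}")
      case True
      have "bounded_linear (\<lambda>v. e \<bullet> B (y + lam e * s) v)"
        using bounded_linear_compose[OF bounded_linear_inner_right linear_B[unfolded linear_conv_bounded_linear]] .
      from bounded_linear.suminf[OF this s, of s "y + lam e * s"] True
      show ?thesis by (simp add: f_def source_def w_def)
    qed (simp add: f_def)
    have "e \<bullet> w (y + lam e * t, t) = (\<Sum>k. e \<bullet> dyson u k (y + lam e * t, t))"
      unfolding w_def by (rule bounded_linear.suminf[OF bounded_linear_inner_right s[OF t]])
    \<comment> \<open>The head of the series carries the initial value, constant along the
      characteristic; the shifted tail is the series of the source integrals of all terms.\<close>
    also have "\<dots> = e \<bullet> dyson u 0 (y + lam e * t, t) + (\<Sum>k. e \<bullet> dyson u (Suc k) (y + lam e * t, t))"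
      by (subst suminf_split_head[OF bounded_linear.summable[OF bounded_linear_inner_right s[OF t]]]) simp
    also have "e \<bullet> dyson u 0 (y + lam e * t, t) = e \<bullet> w (y, 0)"
      using inner_basis_sum[OF e, of "\<lambda>f. f \<bullet> u (y + lam e * t - lam f * t)"] by (simp add: free_flow_def w0)
    also have "(\<lambda>k. e \<bullet> dyson u (Suc k) (y + lam e * t, t)) = (\<lambda>k. \<integral>s. f k s \<partial>lborel)"
      unfolding dyson.simps duhamel_def fst_conv snd_conv inner_basis_sum[OF e] f_def by simp
    also have "(\<Sum>k. \<integral>s. f k s \<partial>lborel) = (\<integral>s. (\<Sum>k. f k s) \<partial>lborel)"
      by (rule integral_suminf[symmetric]) (use fi fs fis in auto)
    finally show "e \<bullet> w (y + lam e * t, t) = e \<bullet> w (y, 0) + (\<integral>s. indicator {0..t} s * source e w y s \<partial>lborel)"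
      by (simp add: src)
  qed
  then show ?thesis using w0 by blast
qed

section \<open>Energy estimate for mild solutions\<close>

lemma mild_slice:
  assumes w: "mild w" and t: "t \<ge> 0"
  obtains M R where "M \<ge> 0" "R \<ge> 0" "\<And>x. norm (w (x, t)) \<le> M" "\<And>x. \<bar>x\<bar> > R \<Longrightarrow> w (x, t) = 0"
    "(\<lambda>x. w (x, t)) \<in> borel_measurable borel"
proof -
  obtain M where M: "M \<ge> 0" "\<And>x s. 0 \<le> s \<Longrightarrow> s \<le> t \<Longrightarrow> norm (w (x, s)) \<le> M"
    using mild_bound[OF w, of t] by blast
  obtain R where R: "R \<ge> 0" "\<And>x s. 0 \<le> s \<Longrightarrow> \<bar>x\<bar> > R + L * s \<Longrightarrow> w (x, s) = 0"
    using mild_support[OF w] by blast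
  have "(\<lambda>x. w (x, t)) \<in> borel_measurable borel"
    by (intro borel_measurable_compose_Pair[OF mild_measurable[OF w]] measurable_ident_sets[OF refl] borel_measurable_const)
  moreover have "0 \<le> R + L * t" using R(1) L_nonneg t by simp
  ultimately show ?thesis
    using that[of M "R + L * t"] M(1) M(2)[OF t order_refl] R(2)[OF t] by blast
qed

lemma integrable_mild_slice:
  fixes F :: "'a \<Rightarrow> real"
  assumes w: "mild w" and t: "t \<ge> 0" and F: "F \<in> borel_measurable borel" "F 0 = 0"
    and b: "\<And>N. \<exists>K. \<forall>v. norm v \<le> N \<longrightarrow> \<bar>F v\<bar> \<le> K"
  shows "integrable lborel (\<lambda>x. F (w (x, t)))"
proof -
  obtain M R where M: "M \<ge> 0" "R \<ge> 0" "\<And>x. norm (w (x, t)) \<le> M" "\<And>x. \<bar>x\<bar> > R \<Longrightarrow> w (x, t) = 0"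
    and m: "(\<lambda>x. w (x, t)) \<in> borel_measurable borel" using mild_slice[OF w t] by blast
  obtain K where K: "\<And>v. norm v \<le> M \<Longrightarrow> \<bar>F v\<bar> \<le> K" using b by blast
  show ?thesis
  proof (rule integrable_bounded_support[where A = "{-R..R}" and M = K])
    show "(\<lambda>x. F (w (x, t))) \<in> borel_measurable borel" by (rule measurable_compose[OF m F(1)])
    show "F (w (x, t)) = 0" if "x \<notin> {-R..R}" for x
    proof -
      have "\<bar>x\<bar> > R" using that by auto
      then show ?thesis by (simp add: M(4) F(2))
    qed
    show "norm (F (w (x, t))) \<le> K" for x using K[OF M(3)] by simp
  qed auto
qed

lemma integrable_mild_inner_sq:
  assumes "mild w" "t \<ge> 0" "e \<in> E"
  shows "integrable lborel (\<lambda>x. (e \<bullet> w (x, t))\<^sup>2)"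
proof (rule integrable_mild_slice[OF assms(1,2)])
  show "\<exists>K. \<forall>v. norm v \<le> N \<longrightarrow> \<bar>(e \<bullet> v)\<^sup>2\<bar> \<le> K" for N
  proof (intro exI allI impI)
    fix v :: 'a assume "norm v \<le> N"
    then have "\<bar>e \<bullet> v\<bar> \<le> N" using inner_basis_le[OF assms(3), of v] by simp
    then show "\<bar>(e \<bullet> v)\<^sup>2\<bar> \<le> N\<^sup>2" using power_mono[of "\<bar>e \<bullet> v\<bar>" N 2] by simp
  qed
qed auto

lemma integrable_mild_norm_sq:
  assumes "mild w" "t \<ge> 0"
  shows "integrable lborel (\<lambda>x. (norm (w (x, t)))\<^sup>2)"
  unfolding norm_expand by (intro Bochner_Integration.integrable_sum integrable_mild_inner_sq assms)

lemma borel_measurable_source_line: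
  assumes "w \<in> borel_measurable borel" shows "source e w y \<in> borel_measurable borel"
  by (intro borel_measurable_source[OF assms, of "\<lambda>_. y" borel "\<lambda>s. s"] borel_measurable_const measurable_ident_sets[OF refl])

lemma borel_measurable_line:
  fixes w :: "real \<times> real \<Rightarrow> 'a"
  assumes "w \<in> borel_measurable borel" shows "(\<lambda>t. w (y + c * t, t)) \<in> borel_measurable borel"
  by (intro borel_measurable_compose_Pair[OF assms] borel_measurable_continuous_onI continuous_intros)

text \<open>On the characteristic the component is a + H with H the primitive of the source h. In
  the square a^2 + 2 a H + H^2 the last term is twice the integral of h H, by
  \<open>integral_by_parts_primitives\<close> with both functions equal to h. No pointwise
  derivative of the component is used.\<close>

lemma mild_square:
  assumes w: "mild w" and e: "e \<in> E" and T: "T \<ge> 0"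
  shows "(e \<bullet> w (y + lam e * T, T))\<^sup>2 = (e \<bullet> w (y, 0))\<^sup>2
    + 2 * (\<integral>t. indicator {0..T} t * (source e w y t * (e \<bullet> w (y + lam e * t, t))) \<partial>lborel)"
proof -
  obtain M where M: "M \<ge> 0" "\<And>x s. 0 \<le> s \<Longrightarrow> s \<le> T \<Longrightarrow> norm (w (x, s)) \<le> M"
    using mild_bound[OF w, of T] by blast
  define h where "h = source e w y"
  define a where "a = e \<bullet> w (y, 0)"
  define H where "H t = (\<integral>s. indicator {0..t} s * h s \<partial>lborel)" for t
  have mh: "h \<in> borel_measurable borel"
    unfolding h_def by (rule borel_measurable_source_line[OF mild_measurable[OF w]])
  have mv: "(\<lambda>t. e \<bullet> w (y + lam e * t, t)) \<in> borel_measurable borel"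
    by (intro borel_measurable_inner borel_measurable_const borel_measurable_line mild_measurable w)
  have bh: "\<bar>h s\<bar> \<le> C * M" if "0 \<le> s" "s \<le> T" for s
    unfolding h_def using source_le[OF e] mult_left_mono[OF M(2)[OF that] C_nonneg] by (rule order_trans)
  have bv: "\<bar>e \<bullet> w (y + lam e * s, s)\<bar> \<le> M" if "0 \<le> s" "s \<le> T" for s
    using inner_basis_le[OF e] M(2)[OF that] by (rule order_trans)
  have eq: "e \<bullet> w (y + lam e * t, t) = a + H t" if "t \<ge> 0" for t
    using mild_eq[OF w e that] by (simp add: a_def H_def h_def)
  have ih: "integrable lborel (\<lambda>t. indicator {0..T} t * h t)"
    by (rule integrable_bounded_Icc[OF mh bh])
  have ihv: "integrable lborel (\<lambda>t. indicator {0..T} t * (h t * (e \<bullet> w (y + lam e * t, t))))"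
  proof (rule integrable_bounded_Icc[where M = "(C * M) * M"])
    show "\<bar>h s * (e \<bullet> w (y + lam e * s, s))\<bar> \<le> C * M * M" if "0 \<le> s" "s \<le> T" for s
      unfolding abs_mult using that C_nonneg M(1) by (intro mult_mono bh bv) auto
  qed (intro borel_measurable_times mh mv)
  have "(\<integral>t. indicator {0..T} t * (h t * H t) \<partial>lborel)
      = (\<integral>t. indicator {0..T} t * (h t * (e \<bullet> w (y + lam e * t, t))) - a * (indicator {0..T} t * h t) \<partial>lborel)"
    by (rule Bochner_Integration.integral_cong[OF refl]) (auto simp: indicator_def eq distrib_left mult.commute[of a])
  also have "\<dots> = (\<integral>t. indicator {0..T} t * (h t * (e \<bullet> w (y + lam e * t, t))) \<partial>lborel) - a * H T"
    using ih ihv by (simp add: H_def)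
  finally have 1: "(\<integral>t. indicator {0..T} t * (h t * H t) \<partial>lborel)
      = (\<integral>t. indicator {0..T} t * (h t * (e \<bullet> w (y + lam e * t, t))) \<partial>lborel) - a * H T" .
  have "2 * (\<integral>t. indicator {0..T} t * (h t * H t) \<partial>lborel) = H T * H T"
    using integral_by_parts_primitives[OF mh mh bh bh] unfolding H_def by simp
  then show ?thesis using 1 eq[OF T] unfolding h_def[symmetric] a_def[symmetric]
    by (simp add: power2_eq_square algebra_simps)
qed

text \<open>The identity of \<open>mild_square\<close> is integrated over all feet and carried back
  to space-time. The integral for a single \<open>e\<close> need not have a sign; summed over
  \<open>E\<close>, the integrands recombine to \<open>w z \<bullet> B (fst z) (w z)\<close>, which
  is nonpositive.\<close>

lemma mild_energy:
  assumes w: "mild w" and T: "T \<ge> 0"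
  shows "(\<integral>x. (norm (w (x, T)))\<^sup>2 \<partial>lborel) \<le> (\<integral>x. (norm (w (x, 0)))\<^sup>2 \<partial>lborel)"
proof -
  obtain M where M: "M \<ge> 0" "\<And>x s. 0 \<le> s \<Longrightarrow> s \<le> T \<Longrightarrow> norm (w (x, s)) \<le> M"
    using mild_bound[OF w, of T] by blast
  obtain R where R: "R \<ge> 0" "\<And>x s. 0 \<le> s \<Longrightarrow> \<bar>x\<bar> > R + L * s \<Longrightarrow> w (x, s) = 0"
    using mild_support[OF w] by blast
  define g where "g e z = indicator {0..T} (snd z) * ((e \<bullet> B (fst z) (w z)) * (e \<bullet> w z))" for e and z :: "real \<times> real"
  have mg: "g e \<in> borel_measurable borel" for e
  proof -
    have 1: "fst \<in> borel_measurable (borel :: (real \<times> real) measure)" and 2: "snd \<in> borel_measurable (borel :: (real \<times> real) measure)"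
      by (auto intro!: borel_measurable_continuous_onI continuous_intros)
    show ?thesis unfolding g_def
      by (intro borel_measurable_times borel_measurable_inner borel_measurable_const borel_measurable_B
          mild_measurable w 1 2 borel_measurable_indicator_Icc)
  qed
  have bg: "\<bar>g e (x, t)\<bar> \<le> (C * M) * M" if e: "e \<in> E" and t: "0 \<le> t" "t \<le> T" for e x t
  proof -
    have "\<bar>e \<bullet> B x (w (x, t))\<bar> \<le> C * M"
      using order_trans[OF inner_basis_le[OF e] norm_B] mult_left_mono[OF M(2)[OF t] C_nonneg] by (rule order_trans)
    moreover have "\<bar>e \<bullet> w (x, t)\<bar> \<le> M" using inner_basis_le[OF e] M(2)[OF t] by (rule order_trans)
    ultimately show ?thesis using t M(1) C_nonneg by (simp add: g_def abs_mult mult_mono)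
  qed
  have zg: "g e (x, t) = 0" if "\<not> (\<bar>x\<bar> \<le> R + L * T \<and> 0 \<le> t \<and> t \<le> T)" for e x t
  proof (cases "t \<in> {0..T}")
    case True
    then have "L * t \<le> L * T" using L_nonneg by (simp add: mult_left_mono)
    then have "w (x, t) = 0" using R(2)[of t x] True that by auto
    then show ?thesis by (simp add: g_def)
  qed (simp add: g_def)
  have ig: "integrable lborel (g e)" if "e \<in> E" for e
    by (rule integrable_bounded_box[OF mg bg[OF that] zg])
  have comp: "(\<integral>x. (e \<bullet> w (x, T))\<^sup>2 \<partial>lborel) = (\<integral>x. (e \<bullet> w (x, 0))\<^sup>2 \<partial>lborel) + 2 * integral\<^sup>L lborel (g e)"
    if e: "e \<in> E" for e
  proof -
    have eqg: "g e (y + lam e * t, t) = indicator {0..T} t * (source e w y t * (e \<bullet> w (y + lam e * t, t)))" for y t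
      by (simp add: g_def source_def)
    have char: "integral\<^sup>L lborel (g e) = (\<integral>y. (\<integral>t. g e (y + lam e * t, t) \<partial>lborel) \<partial>lborel)"
      and ichar: "integrable lborel (\<lambda>y. \<integral>t. g e (y + lam e * t, t) \<partial>lborel)"
      by (rule integral_along_characteristics[OF mg bg[OF e] zg]; assumption)+
    \<comment> \<open>The slice at time T is reparametrised by the feet of the characteristics,
      which is a translation by \<open>lam e * T\<close>.\<close>
    have "(\<integral>x. (e \<bullet> w (x, T))\<^sup>2 \<partial>lborel) = (\<integral>y. (e \<bullet> w (y + lam e * T, T))\<^sup>2 \<partial>lborel)"
      by (rule integral_translate[of "\<lambda>x. (e \<bullet> w (x, T))\<^sup>2", symmetric])
    also have "\<dots> = (\<integral>y. (e \<bullet> w (y, 0))\<^sup>2 + 2 * (\<integral>t. g e (y + lam e * t, t) \<partial>lborel) \<partial>lborel)"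
      unfolding mild_square[OF w e T] eqg ..
    also have "\<dots> = (\<integral>x. (e \<bullet> w (x, 0))\<^sup>2 \<partial>lborel) + 2 * integral\<^sup>L lborel (g e)"
      using ichar integrable_mild_inner_sq[OF w order_refl e] unfolding char by simp
    finally show ?thesis .
  qed
  have "(\<Sum>e\<in>E. integral\<^sup>L lborel (g e)) = (\<integral>z. (\<Sum>e\<in>E. g e z) \<partial>lborel)"
    using ig by (rule Bochner_Integration.integral_sum[symmetric])
  also have "\<dots> = - (\<integral>z. - (\<Sum>e\<in>E. g e z) \<partial>lborel)" by simp
  also have "\<dots> \<le> 0"
  proof -
    have "0 \<le> - (\<Sum>e\<in>E. g e z)" for z
    proof -
      have "(\<Sum>e\<in>E. g e z) = indicator {0..T} (snd z) * (w z \<bullet> B (fst z) (w z))"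
        unfolding g_def sum_distrib_left[symmetric] inner_expand[of "w z"] by (simp add: mult.commute)
      then show ?thesis using dissipative[of "w z" "fst z"] by (simp add: indicator_def)
    qed
    then show ?thesis by (simp only: neg_le_0_iff_le) (intro integral_nonneg_AE AE_I2; simp)
  qed
  finally have neg: "(\<Sum>e\<in>E. integral\<^sup>L lborel (g e)) \<le> 0" .
  have expd: "(\<integral>x. (norm (w (x, t)))\<^sup>2 \<partial>lborel) = (\<Sum>e\<in>E. (\<integral>x. (e \<bullet> w (x, t))\<^sup>2 \<partial>lborel))" if "t \<ge> 0" for t
    unfolding norm_expand by (intro Bochner_Integration.integral_sum integrable_mild_inner_sq w that)
  have "(\<integral>x. (norm (w (x, T)))\<^sup>2 \<partial>lborel)
      = (\<Sum>e\<in>E. (\<integral>x. (e \<bullet> w (x, 0))\<^sup>2 \<partial>lborel)) + 2 * (\<Sum>e\<in>E. integral\<^sup>L lborel (g e))"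
    unfolding expd[OF T] by (simp add: comp sum.distrib sum_distrib_left)
  then show ?thesis using neg unfolding expd[OF order_refl] by linarith
qed

section \<open>Weak formulation for mild solutions\<close>

text \<open>\<open>\<phi>1\<close> and \<open>\<phi>2\<close> stand for the derivatives of the test function \<open>\<phi>\<close> in \<open>x\<close> and \<open>t\<close>;
  the sum is \<open>\<phi>1 \<bullet> A w\<close> in the eigenbasis of \<open>A\<close>.\<close>

definition weak_integrand ::
  "(real \<times> real \<Rightarrow> 'a) \<Rightarrow> (real \<times> real \<Rightarrow> 'a) \<Rightarrow> (real \<times> real \<Rightarrow> 'a) \<Rightarrow> (real \<times> real \<Rightarrow> 'a) \<Rightarrow> real \<times> real \<Rightarrow> real" where
  "weak_integrand \<phi> \<phi>1 \<phi>2 w z =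
     \<phi>2 z \<bullet> w z + (\<Sum>e\<in>E. lam e * ((e \<bullet> \<phi>1 z) * (e \<bullet> w z))) + \<phi> z \<bullet> B (fst z) (w z)"

text \<open>Along a characteristic of \<open>e\<close> the integrand is the derivative of a product:
  the component of the test function times the component of \<open>w\<close>. The test function
  vanishes at times 0 and T, so the integral over every characteristic is zero, and so are the
  integral over space-time and the sum over \<open>E\<close>.\<close>

lemma mild_weak:
  assumes w: "mild w"
    and der: "\<And>z. (\<phi> has_derivative (\<lambda>h. fst h *\<^sub>R \<phi>1 z + snd h *\<^sub>R \<phi>2 z)) (at z)"
    and c1: "continuous_on UNIV \<phi>1" and c2: "continuous_on UNIV \<phi>2"
    and T: "T \<ge> 0"
    and box: "\<And>x t. \<not> (\<bar>x\<bar> \<le> R \<and> 0 < t \<and> t < T) \<Longrightarrow> \<phi> (x, t) = 0 \<and> \<phi>1 (x, t) = 0 \<and> \<phi>2 (x, t) = 0"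
  shows "integrable lborel (weak_integrand \<phi> \<phi>1 \<phi>2 w)" "integral\<^sup>L lborel (weak_integrand \<phi> \<phi>1 \<phi>2 w) = 0"
proof -
  obtain M where M: "M \<ge> 0" "\<And>x s. 0 \<le> s \<Longrightarrow> s \<le> T \<Longrightarrow> norm (w (x, s)) \<le> M"
    using mild_bound[OF w, of T] by blast
  have c0: "continuous_on UNIV \<phi>"
    by (intro continuous_at_imp_continuous_on ballI has_derivative_continuous[OF der])
  define K where "K = {-R..R} \<times> {0..T}"
  have K: "compact K" unfolding K_def by (intro compact_Times) auto
  have out: "\<phi> z = 0" "\<phi>1 z = 0" "\<phi>2 z = 0" if "z \<notin> K" for z
    using box[of "fst z" "snd z"] that unfolding K_def by (auto simp: mem_Times_iff abs_le_iff)
  obtain N0 where N0: "N0 \<ge> 0" "\<And>z. norm (\<phi> z) \<le> N0"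
    using bounded_if_continuous_compact_support[OF continuous_on_subset[OF c0] K out(1)] by auto
  obtain N1 where N1: "N1 \<ge> 0" "\<And>z. norm (\<phi>1 z) \<le> N1"
    using bounded_if_continuous_compact_support[OF continuous_on_subset[OF c1] K out(2)] by auto
  obtain N2 where N2: "N2 \<ge> 0" "\<And>z. norm (\<phi>2 z) \<le> N2"
    using bounded_if_continuous_compact_support[OF continuous_on_subset[OF c2] K out(3)] by auto
  \<comment> \<open>The derivative of the component of the test function in the characteristic
    direction (lam e, 1).\<close>
  define p where "p e z = e \<bullet> \<phi>2 z + lam e * (e \<bullet> \<phi>1 z)" for e z
  define N where "N = N2 + L * N1"
  have N: "N \<ge> 0" unfolding N_def using N1 N2 L_nonneg by simp
  have p: "\<bar>p e z\<bar> \<le> N" if e: "e \<in> E" for e z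
  proof -
    have "\<bar>e \<bullet> \<phi>2 z\<bar> \<le> N2" using inner_basis_le[OF e] N2(2) by (rule order_trans)
    moreover have "\<bar>e \<bullet> \<phi>1 z\<bar> \<le> N1" using inner_basis_le[OF e] N1(2) by (rule order_trans)
    then have "\<bar>lam e * (e \<bullet> \<phi>1 z)\<bar> \<le> L * N1"
      unfolding abs_mult using lam_bound[OF e] L_nonneg by (intro mult_mono) auto
    ultimately show ?thesis unfolding p_def N_def by linarith
  qed
  have p\<phi>: "\<bar>e \<bullet> \<phi> z\<bar> \<le> N0" if e: "e \<in> E" for e z
    using inner_basis_le[OF e] N0(2) by (rule order_trans)
  define g where "g e z = p e z * (e \<bullet> w z) + (e \<bullet> \<phi> z) * (e \<bullet> B (fst z) (w z))" for e z
  have Fg: "weak_integrand \<phi> \<phi>1 \<phi>2 w = (\<lambda>z. \<Sum>e\<in>E. g e z)"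
    unfolding weak_integrand_def[abs_def] g_def p_def
    by (simp add: inner_expand[of "\<phi>2 _" "w _"] inner_expand[of "\<phi> _" "B _ _"] sum.distrib distrib_right mult.assoc)
  have cp: "continuous_on UNIV (p e)" for e
    unfolding p_def by (intro continuous_intros c1 c2)
  have mg: "g e \<in> borel_measurable borel" for e
  proof -
    have 1: "fst \<in> borel_measurable (borel :: (real \<times> real) measure)"
      by (auto intro!: borel_measurable_continuous_onI continuous_intros)
    show ?thesis unfolding g_def
      by (intro borel_measurable_add borel_measurable_times borel_measurable_inner borel_measurable_const borel_measurable_B
          mild_measurable w 1 borel_measurable_continuous_onI[OF c0] borel_measurable_continuous_onI[OF cp])
  qed
  have bw: "\<bar>e \<bullet> w (x, t)\<bar> \<le> M" if e: "e \<in> E" and t: "0 \<le> t" "t \<le> T" for e x t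
    using inner_basis_le[OF e] M(2)[OF t] by (rule order_trans)
  have bB: "\<bar>e \<bullet> B x (w (x, t))\<bar> \<le> C * M" if e: "e \<in> E" and t: "0 \<le> t" "t \<le> T" for e x t
    using order_trans[OF inner_basis_le[OF e] norm_B] mult_left_mono[OF M(2)[OF t] C_nonneg] by (rule order_trans)
  have bg: "\<bar>g e (x, t)\<bar> \<le> N * M + N0 * (C * M)" if e: "e \<in> E" and t: "0 \<le> t" "t \<le> T" for e x t
  proof -
    have "\<bar>p e (x, t) * (e \<bullet> w (x, t))\<bar> \<le> N * M"
      unfolding abs_mult using p[OF e] bw[OF e t] N by (intro mult_mono) auto
    moreover have "\<bar>(e \<bullet> \<phi> (x, t)) * (e \<bullet> B x (w (x, t)))\<bar> \<le> N0 * (C * M)"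
      unfolding abs_mult using p\<phi>[OF e] bB[OF e t] N0 by (intro mult_mono) auto
    ultimately show ?thesis unfolding g_def fst_conv by linarith
  qed
  have zg: "g e (x, t) = 0" if "\<not> (\<bar>x\<bar> \<le> R \<and> 0 \<le> t \<and> t \<le> T)" for e x t
    using box[of x t] that unfolding g_def p_def by auto
  have ig: "integrable lborel (g e)" if "e \<in> E" for e
    by (rule integrable_bounded_box[OF mg bg[OF that] zg])
  show "integrable lborel (weak_integrand \<phi> \<phi>1 \<phi>2 w)"
    unfolding Fg by (intro Bochner_Integration.integrable_sum ig)
  have line: "(\<integral>t. g e (y + lam e * t, t) \<partial>lborel) = 0" if e: "e \<in> E" for e y
  proof -
    define \<psi> where "\<psi> t = e \<bullet> \<phi> (y + lam e * t, t)" for t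
    define \<psi>' where "\<psi>' t = p e (y + lam e * t, t)" for t
    define h where "h = source e w y"
    define a where "a = e \<bullet> w (y, 0)"
    define H where "H t = (\<integral>s. indicator {0..t} s * h s \<partial>lborel)" for t
    have mh: "h \<in> borel_measurable borel"
      unfolding h_def by (rule borel_measurable_source_line[OF mild_measurable[OF w]])
    have mv: "(\<lambda>t. e \<bullet> w (y + lam e * t, t)) \<in> borel_measurable borel"
      by (intro borel_measurable_inner borel_measurable_const borel_measurable_line mild_measurable w)
    have line_cont: "continuous_on UNIV (\<lambda>t. f (y + lam e * t, t))" if "continuous_on UNIV f" for f :: "real \<times> real \<Rightarrow> 'c::topological_space"
      by (rule continuous_on_compose2[OF that]) (auto intro!: continuous_intros)
    have c\<psi>': "continuous_on UNIV \<psi>'" unfolding \<psi>'_def by (rule line_cont[OF cp])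
    have m\<psi>': "\<psi>' \<in> borel_measurable borel" by (rule borel_measurable_continuous_onI[OF c\<psi>'])
    have m\<psi>: "\<psi> \<in> borel_measurable borel" unfolding \<psi>_def
      by (intro borel_measurable_continuous_onI continuous_intros line_cont[OF c0])
    have d: "DERIV \<psi> t :> \<psi>' t" for t
    proof -
      have "((\<lambda>t. (y + lam e * t, t)) has_derivative (\<lambda>h. (lam e * h, h))) (at t)"
        by (auto intro!: derivative_eq_intros)
      from has_derivative_compose[OF this der]
      have "((\<lambda>t. \<phi> (y + lam e * t, t)) has_derivative
          (\<lambda>h. (lam e * h) *\<^sub>R \<phi>1 (y + lam e * t, t) + h *\<^sub>R \<phi>2 (y + lam e * t, t))) (at t)" by simp
      from has_derivative_inner_right[OF this, of e]
      show ?thesis unfolding has_field_derivative_def \<psi>_def \<psi>'_def p_def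
        by (rule has_derivative_eq_rhs) (auto simp: fun_eq_iff inner_add_right algebra_simps)
    qed
    \<comment> \<open>The strict inequalities in \<open>box\<close> matter here: they force the test
      function to vanish at t = 0 and t = T themselves.\<close>
    have \<psi>0: "\<psi> 0 = 0" and \<psi>T: "\<psi> T = 0" unfolding \<psi>_def using box by auto
    have prim: "\<psi> t = (\<integral>s. indicator {0..t} s * \<psi>' s \<partial>lborel)" if "t \<ge> 0" for t
      using integral_FTC_Icc_real[OF that, of \<psi> \<psi>'] d c\<psi>' \<psi>0
      by (simp add: mult.commute continuous_on_eq_continuous_at)
    have eq: "e \<bullet> w (y + lam e * t, t) = a + H t" if "t \<ge> 0" for t
      using mild_eq[OF w e that] by (simp add: a_def H_def h_def)
    \<comment> \<open>Integration by parts takes one bound for both functions, hence the common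
      maximum here and for the derivative of the test function.\<close>
    have bh: "\<bar>h s\<bar> \<le> max N (C * M)" if "0 \<le> s" "s \<le> T" for s
      unfolding h_def source_def using bB[OF e that] by (simp add: le_max_iff_disj)
    have b\<psi>': "\<bar>\<psi>' s\<bar> \<le> max N (C * M)" for s
      unfolding \<psi>'_def using p[OF e] by (simp add: le_max_iff_disj)
    have i1: "integrable lborel (\<lambda>t. indicator {0..T} t * \<psi>' t)"
      by (rule integrable_bounded_Icc[OF m\<psi>' b\<psi>'])
    have i2: "integrable lborel (\<lambda>t. indicator {0..T} t * (\<psi>' t * (e \<bullet> w (y + lam e * t, t))))"
    proof (rule integrable_bounded_Icc[where M = "max N (C * M) * M"])
      show "\<bar>\<psi>' s * (e \<bullet> w (y + lam e * s, s))\<bar> \<le> max N (C * M) * M" if "0 \<le> s" "s \<le> T" for s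
        unfolding abs_mult using N bw[OF e that] by (intro mult_mono b\<psi>') auto
    qed (intro borel_measurable_times m\<psi>' mv)
    have i3: "integrable lborel (\<lambda>t. indicator {0..T} t * (h t * \<psi> t))"
    proof (rule integrable_bounded_Icc[where M = "max N (C * M) * N0"])
      show "\<bar>h s * \<psi> s\<bar> \<le> max N (C * M) * N0" if "0 \<le> s" "s \<le> T" for s
        unfolding abs_mult using N p\<phi>[OF e] by (intro mult_mono bh that) (auto simp: \<psi>_def)
    qed (intro borel_measurable_times mh m\<psi>)
    have "(\<integral>t. indicator {0..T} t * (\<psi>' t * H t) \<partial>lborel)
        = (\<integral>t. indicator {0..T} t * (\<psi>' t * (e \<bullet> w (y + lam e * t, t))) - a * (indicator {0..T} t * \<psi>' t) \<partial>lborel)"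
      by (rule Bochner_Integration.integral_cong[OF refl]) (auto simp: indicator_def eq distrib_left mult.commute[of a])
    also have "\<dots> = (\<integral>t. indicator {0..T} t * (\<psi>' t * (e \<bullet> w (y + lam e * t, t))) \<partial>lborel) - a * \<psi> T"
      using i1 i2 by (simp add: prim[OF T])
    finally have 1: "(\<integral>t. indicator {0..T} t * (\<psi>' t * H t) \<partial>lborel)
        = (\<integral>t. indicator {0..T} t * (\<psi>' t * (e \<bullet> w (y + lam e * t, t))) \<partial>lborel)" using \<psi>T by simp
    have 2: "(\<integral>t. indicator {0..T} t * (h t * (\<integral>s. indicator {0..t} s * \<psi>' s \<partial>lborel)) \<partial>lborel)
        = (\<integral>t. indicator {0..T} t * (h t * \<psi> t) \<partial>lborel)"
      by (rule Bochner_Integration.integral_cong[OF refl]) (auto simp: indicator_def prim)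
    \<comment> \<open>The boundary product contains the integral of \<open>\<psi>'\<close> over
      [0, T], which is \<open>\<psi> T = 0\<close>.\<close>
    have 3: "(\<integral>t. indicator {0..T} t * (\<psi>' t * (e \<bullet> w (y + lam e * t, t))) \<partial>lborel)
        + (\<integral>t. indicator {0..T} t * (h t * \<psi> t) \<partial>lborel) = 0"
      using integral_by_parts_primitives[OF m\<psi>' mh b\<psi>' bh, of T] prim[OF T] \<psi>T
      unfolding H_def[symmetric] 1 2 by simp
    have "(\<integral>t. g e (y + lam e * t, t) \<partial>lborel)
        = (\<integral>t. indicator {0..T} t * (\<psi>' t * (e \<bullet> w (y + lam e * t, t))) + indicator {0..T} t * (h t * \<psi> t) \<partial>lborel)"
    proof (rule Bochner_Integration.integral_cong[OF refl])
      fix t :: real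
      show "g e (y + lam e * t, t) = indicator {0..T} t * (\<psi>' t * (e \<bullet> w (y + lam e * t, t))) + indicator {0..T} t * (h t * \<psi> t)"
      proof (cases "t \<in> {0..T}")
        case True
        then show ?thesis by (simp add: g_def \<psi>'_def \<psi>_def h_def source_def mult.commute)
      next
        case False
        then show ?thesis using zg[of "y + lam e * t" t e] by auto
      qed
    qed
    also have "\<dots> = 0" using i2 i3 3 by simp
    finally show ?thesis .
  qed
  have "integral\<^sup>L lborel (g e) = 0" if e: "e \<in> E" for e
  proof -
    have "integral\<^sup>L lborel (g e) = (\<integral>y. (\<integral>t. g e (y + lam e * t, t) \<partial>lborel) \<partial>lborel)"
      by (rule integral_along_characteristics(1)[OF mg bg[OF e] zg]; assumption)
    then show ?thesis by (simp add: line[OF e])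
  qed
  then show "integral\<^sup>L lborel (weak_integrand \<phi> \<phi>1 \<phi>2 w) = 0"
    unfolding Fg using ig by (simp add: Bochner_Integration.integral_sum)
qed

section \<open>Continuity in time of mild solutions\<close>

text \<open>Moving a point of the slice at t along its characteristic to time t0 changes the
  component by at most C M |t - t0|. What remains is the difference between the slice at t0 and its
  translate by \<open>lam e * (t0 - t)\<close>, small in L1; boundedness turns this into a bound for
  the square.\<close>

lemma mild_continuous_in_time:
  assumes w: "mild w" and t0: "t0 \<ge> 0"
  shows "((\<lambda>t. \<integral>x. (norm (w (x, t) - w (x, t0)))\<^sup>2 \<partial>lborel) \<longlongrightarrow> 0) (at t0 within {0..})"
proof -
  define T where "T = t0 + 1"
  have T: "T \<ge> 0" "t0 \<le> T" unfolding T_def using t0 by auto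
  obtain M where M: "M \<ge> 0" "\<And>x s. 0 \<le> s \<Longrightarrow> s \<le> T \<Longrightarrow> norm (w (x, s)) \<le> M"
    using mild_bound[OF w, of T] by blast
  obtain R where R: "R \<ge> 0" "\<And>x s. 0 \<le> s \<Longrightarrow> \<bar>x\<bar> > R + L * s \<Longrightarrow> w (x, s) = 0"
    using mild_support[OF w] by blast
  \<comment> \<open>Wide enough that for |x| > R' both x and the shifted point, at distance at most
    L T from it, lie outside R + L T, where all slices up to time T vanish.\<close>
  define R' where "R' = R + 3 * L * T"
  have R': "R' \<ge> 0" unfolding R'_def using R(1) L_nonneg T by simp
  define f where "f e t x = e \<bullet> w (x, t)" for e t x
  have mf: "f e t \<in> borel_measurable borel" for e t
    unfolding f_def by (intro borel_measurable_inner borel_measurable_const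
      borel_measurable_compose_Pair[OF mild_measurable[OF w]] measurable_ident_sets[OF refl])
  have bf: "\<bar>f e t x\<bar> \<le> M" if "e \<in> E" "0 \<le> t" "t \<le> T" for e t x
    unfolding f_def using inner_basis_le[OF that(1)] M(2)[OF that(2,3)] by (rule order_trans)
  have zf: "f e t x = 0" if t: "0 \<le> t" "t \<le> T" and x: "\<bar>x\<bar> > R + L * T" for e t x
  proof -
    have "L * t \<le> L * T" using L_nonneg t by (simp add: mult_left_mono)
    then show ?thesis unfolding f_def using R(2)[of t x] t x by simp
  qed
  have if': "integrable lborel (f e t)" if e: "e \<in> E" and t: "0 \<le> t" "t \<le> T" for e t
    by (rule integrable_bounded_support[where A = "{-(R + L * T)..R + L * T}" and M = M])
      (use mf bf[OF e t] zf[OF t] in \<open>auto simp: abs_if split: if_splits\<close>)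
  have est: "(\<integral>x. (f e t x - f e t0 x)\<^sup>2 \<partial>lborel)
      \<le> 2 * M * (C * M * \<bar>t - t0\<bar> * (2 * R') + (\<integral>x. \<bar>f e t0 (x + lam e * (t0 - t)) - f e t0 x\<bar> \<partial>lborel))"
    if e: "e \<in> E" and t: "0 \<le> t" "t \<le> T" for e t
  proof -
    define d where "d = lam e * (t0 - t)"
    have lip: "\<bar>f e t x - f e t0 (x + d)\<bar> \<le> C * M * \<bar>t - t0\<bar> * indicator {-R'..R'} x" for x
    proof (cases "x \<in> {-R'..R'}")
      case True
      define y where "y = x - lam e * t"
      define h where "h = source e w y"
      have mh: "h \<in> borel_measurable borel"
        unfolding h_def by (rule borel_measurable_source_line[OF mild_measurable[OF w]])
      have bh: "\<bar>h s\<bar> \<le> C * M" if "0 \<le> s" "s \<le> T" for s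
        unfolding h_def using source_le[OF e] mult_left_mono[OF M(2)[OF that] C_nonneg] by (rule order_trans)
      have ih: "integrable lborel (\<lambda>s. indicator {0..u} s * h s)" if "u \<le> T" for u
        by (rule integrable_bounded_Icc[OF mh, where M = "C * M"]) (use bh that in auto)
      have x: "x = y + lam e * t" "x + d = y + lam e * t0" unfolding y_def d_def by (auto simp: algebra_simps)
      have "f e t x - f e t0 (x + d)
          = (\<integral>s. indicator {0..t} s * h s \<partial>lborel) - (\<integral>s. indicator {0..t0} s * h s \<partial>lborel)"
        unfolding x(2) unfolding f_def x(1) mild_eq[OF w e t(1)] mild_eq[OF w e t0] h_def by simp
      also have "\<dots> = (\<integral>s. indicator {0..t} s * h s - indicator {0..t0} s * h s \<partial>lborel)"
        using ih[OF t(2)] ih[OF T(2)] by simp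
      finally have "\<bar>f e t x - f e t0 (x + d)\<bar> \<le> (\<integral>s. norm (indicator {0..t} s * h s - indicator {0..t0} s * h s) \<partial>lborel)"
        using integral_norm_bound[of lborel "\<lambda>s. indicator {0..t} s * h s - indicator {0..t0} s * h s"] by simp
      also have "\<dots> \<le> (\<integral>s. indicator {min t t0..max t t0} s *\<^sub>R (C * M) \<partial>lborel)"
      proof (rule integral_mono')
        show "integrable lborel (\<lambda>s. indicator {min t t0..max t t0} s *\<^sub>R (C * M))"
          by (rule integrable_bounded_indicator[where M = "\<bar>C * M\<bar>"]) auto
        fix s :: real
        have CM: "0 \<le> C * M" using C_nonneg M(1) by simp
        then show "0 \<le> indicator {min t t0..max t t0} s *\<^sub>R (C * M)" by simp
        \<comment> \<open>The two truncated sources cancel except between t and t0.\<close>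
        show "norm (indicator {0..t} s * h s - indicator {0..t0} s * h s) \<le> indicator {min t t0..max t t0} s *\<^sub>R (C * M)"
          using bh[of s] T t t0 CM by (auto simp: indicator_def)
      qed
      also have "\<dots> = C * M * \<bar>t - t0\<bar>" by (simp add: min_def max_def mult.commute)
      finally show ?thesis using True by simp
    next
      case False
      then have x: "\<bar>x\<bar> > R + 3 * L * T" unfolding R'_def by auto
      have "\<bar>d\<bar> \<le> L * T"
        unfolding d_def abs_mult using lam_bound[OF e] t t0 T L_nonneg by (intro mult_mono) auto
      moreover have "0 \<le> L * T" using L_nonneg T by simp
      ultimately have "\<bar>x\<bar> > R + L * T" "\<bar>x + d\<bar> > R + L * T" using x by linarith+
      then show ?thesis using zf[OF t] zf[OF t0 T(2)] False by simp
    qed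
    have i1: "integrable lborel (\<lambda>x. C * M * \<bar>t - t0\<bar> * indicator {-R'..R'} x)"
    proof -
      have "integrable lborel (\<lambda>x. indicator {-R'..R'} x *\<^sub>R (C * M * \<bar>t - t0\<bar>))"
        by (rule integrable_bounded_indicator[where M = "\<bar>C * M * \<bar>t - t0\<bar>\<bar>"]) auto
      then show ?thesis by (simp add: mult.commute)
    qed
    have i2: "integrable lborel (\<lambda>x. \<bar>f e t0 (x + d) - f e t0 x\<bar>)"
      by (intro integrable_abs Bochner_Integration.integrable_diff integrable_translate if' e t0 T(2))
    have "(\<integral>x. (f e t x - f e t0 x)\<^sup>2 \<partial>lborel)
        \<le> (\<integral>x. 2 * M * (C * M * \<bar>t - t0\<bar> * indicator {-R'..R'} x + \<bar>f e t0 (x + d) - f e t0 x\<bar>) \<partial>lborel)"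
    proof (rule integral_mono')
      show "integrable lborel (\<lambda>x. 2 * M * (C * M * \<bar>t - t0\<bar> * indicator {-R'..R'} x + \<bar>f e t0 (x + d) - f e t0 x\<bar>))"
        using i1 i2 by (intro integrable_mult_right Bochner_Integration.integrable_add) auto
      fix x
      have 1: "\<bar>f e t x - f e t0 x\<bar> \<le> C * M * \<bar>t - t0\<bar> * indicator {-R'..R'} x + \<bar>f e t0 (x + d) - f e t0 x\<bar>"
        using lip[of x] by linarith
      have 2: "\<bar>f e t x - f e t0 x\<bar> \<le> 2 * M"
        using bf[OF e t, of x] bf[OF e t0 T(2), of x] by linarith
      \<comment> \<open>One factor of the square is bounded by 2 M, the other by the L1-type
        estimate.\<close>
      show "(f e t x - f e t0 x)\<^sup>2 \<le> 2 * M * (C * M * \<bar>t - t0\<bar> * indicator {-R'..R'} x + \<bar>f e t0 (x + d) - f e t0 x\<bar>)"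
        using mult_mono[OF 2 1] M(1) by (simp add: power2_eq_square flip: abs_mult)
      then show "0 \<le> 2 * M * (C * M * \<bar>t - t0\<bar> * indicator {-R'..R'} x + \<bar>f e t0 (x + d) - f e t0 x\<bar>)"
        by (rule order_trans[rotated]) simp
    qed
    also have "\<dots> = 2 * M * (C * M * \<bar>t - t0\<bar> * (2 * R') + (\<integral>x. \<bar>f e t0 (x + d) - f e t0 x\<bar> \<partial>lborel))"
      using i1 i2 R' by simp
    finally show ?thesis unfolding d_def .
  qed
  have lim: "((\<lambda>t. 2 * M * (C * M * \<bar>t - t0\<bar> * (2 * R') + (\<integral>x. \<bar>f e t0 (x + lam e * (t0 - t)) - f e t0 x\<bar> \<partial>lborel)))
      \<longlongrightarrow> 2 * M * (C * M * \<bar>t0 - t0\<bar> * (2 * R') + 0)) (at t0 within {0..})" if e: "e \<in> E" for e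
  proof (intro tendsto_intros)
    let ?I = "\<lambda>h. \<integral>x. \<bar>f e t0 (x + h) - f e t0 x\<bar> \<partial>lborel"
    have "(?I \<longlongrightarrow> ?I 0) (at 0)"
      using L1_translation_continuous[OF if'[OF e t0 T(2)]]
      unfolding L1_translation_continuous_def by simp
    \<comment> \<open>The integral is 0 at shift 0, so the punctured limit extends to a full
      neighbourhood; the composition with the shift then needs no claim that the shift is
      nonzero.\<close>
    then have "(?I \<longlongrightarrow> ?I 0) (nhds 0)" by (rule tendsto_at_iff_tendsto_nhds[THEN iffD1])
    moreover have "((\<lambda>t. lam e * (t0 - t)) \<longlongrightarrow> lam e * (t0 - t0)) (at t0 within {0..})"
      by (intro tendsto_intros)
    ultimately show "((\<lambda>t. ?I (lam e * (t0 - t))) \<longlongrightarrow> 0) (at t0 within {0..})"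
      using filterlim_compose[of ?I "nhds (?I 0)" "nhds 0"] by simp
  qed
  have "((\<lambda>t. \<Sum>e\<in>E. 2 * M * (C * M * \<bar>t - t0\<bar> * (2 * R') + (\<integral>x. \<bar>f e t0 (x + lam e * (t0 - t)) - f e t0 x\<bar> \<partial>lborel)))
      \<longlongrightarrow> (\<Sum>e\<in>E. 2 * M * (C * M * \<bar>t0 - t0\<bar> * (2 * R') + 0))) (at t0 within {0..})"
    by (intro tendsto_sum lim)
  then have ub: "((\<lambda>t. \<Sum>e\<in>E. 2 * M * (C * M * \<bar>t - t0\<bar> * (2 * R') + (\<integral>x. \<bar>f e t0 (x + lam e * (t0 - t)) - f e t0 x\<bar> \<partial>lborel)))
      \<longlongrightarrow> 0) (at t0 within {0..})" by simp
  show ?thesis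
  proof (rule tendsto_sandwich[OF _ _ tendsto_const ub])
    show "\<forall>\<^sub>F t in at t0 within {0..}. 0 \<le> (\<integral>x. (norm (w (x, t) - w (x, t0)))\<^sup>2 \<partial>lborel)"
      by (intro always_eventually allI integral_nonneg_AE AE_I2) simp
    have "\<forall>\<^sub>F t in at t0 within {0..}. t \<in> {0..} \<and> t < T"
      unfolding eventually_at by (intro exI[of _ 1]) (auto simp: T_def dist_real_def)
    then show "\<forall>\<^sub>F t in at t0 within {0..}. (\<integral>x. (norm (w (x, t) - w (x, t0)))\<^sup>2 \<partial>lborel)
       \<le> (\<Sum>e\<in>E. 2 * M * (C * M * \<bar>t - t0\<bar> * (2 * R') + (\<integral>x. \<bar>f e t0 (x + lam e * (t0 - t)) - f e t0 x\<bar> \<partial>lborel)))"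
    proof eventually_elim
      case (elim t)
      then have t: "0 \<le> t" "t \<le> T" by auto
      have "integrable lborel (\<lambda>x. (f e t x - f e t0 x)\<^sup>2)" if e: "e \<in> E" for e
      proof (rule integrable_bounded_support[where A = "{-(R + L * T)..R + L * T}" and M = "(2 * M)\<^sup>2"])
        show "norm ((f e t x - f e t0 x)\<^sup>2) \<le> (2 * M)\<^sup>2" for x
        proof -
          have "\<bar>f e t x - f e t0 x\<bar> \<le> 2 * M"
            using bf[OF e t, of x] bf[OF e t0 T(2), of x] by linarith
          then show ?thesis using power_mono[of "\<bar>f e t x - f e t0 x\<bar>" "2 * M" 2] by simp
        qed
        show "(f e t x - f e t0 x)\<^sup>2 = 0" if "x \<notin> {-(R + L * T)..R + L * T}" for x
        proof -
          have "\<bar>x\<bar> > R + L * T" using that by auto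
          then show ?thesis using zf[OF t] zf[OF t0 T(2)] by simp
        qed
      qed (use mf in auto)
      then have "(\<integral>x. (norm (w (x, t) - w (x, t0)))\<^sup>2 \<partial>lborel) = (\<Sum>e\<in>E. (\<integral>x. (f e t x - f e t0 x)\<^sup>2 \<partial>lborel))"
        unfolding norm_expand inner_diff_right f_def by (rule Bochner_Integration.integral_sum)
      also have "\<dots> \<le> (\<Sum>e\<in>E. 2 * M * (C * M * \<bar>t - t0\<bar> * (2 * R') + (\<integral>x. \<bar>f e t0 (x + lam e * (t0 - t)) - f e t0 x\<bar> \<partial>lborel)))"
        by (intro sum_mono est t)
      finally show ?case .
    qed
  qed
qed

section \<open>Passage to general square integrable data\<close>

lemma weak_integrand_diff:
  "weak_integrand \<phi> \<phi>1 \<phi>2 v z - weak_integrand \<phi> \<phi>1 \<phi>2 w z = weak_integrand \<phi> \<phi>1 \<phi>2 (\<lambda>z. v z - w z) z"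
  unfolding weak_integrand_def
  by (simp add: linear_diff[OF linear_B] inner_diff_right right_diff_distrib sum_subtractf)

text \<open>Together with \<open>weak_integrand_diff\<close> this makes the weak integrand Lipschitz
  in the solution, with a constant that depends only on bounds of the test function and on the
  system.\<close>

lemma weak_integrand_bound:
  assumes n: "norm (\<phi> z) \<le> N0" "norm (\<phi>1 z) \<le> N1" "norm (\<phi>2 z) \<le> N2"
  shows "\<bar>weak_integrand \<phi> \<phi>1 \<phi>2 w z\<bar> \<le> (N2 + card E * (L * N1) + N0 * C) * norm (w z)"
proof -
  have N: "N0 \<ge> 0" "N1 \<ge> 0" "N2 \<ge> 0" using n norm_ge_zero order_trans by blast+
  have "\<bar>\<phi>2 z \<bullet> w z\<bar> \<le> N2 * norm (w z)"
    by (rule order_trans[OF Cauchy_Schwarz_ineq2 mult_right_mono[OF n(3)]]) simp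
  moreover have "\<bar>\<phi> z \<bullet> B (fst z) (w z)\<bar> \<le> N0 * (C * norm (w z))"
    by (rule order_trans[OF Cauchy_Schwarz_ineq2 mult_mono[OF n(1) norm_B]]) (use N in auto)
  moreover have "\<bar>\<Sum>e\<in>E. lam e * ((e \<bullet> \<phi>1 z) * (e \<bullet> w z))\<bar> \<le> (\<Sum>e\<in>E. L * (N1 * norm (w z)))"
  proof (rule order_trans[OF sum_abs sum_mono])
    fix e assume e: "e \<in> E"
    have "\<bar>e \<bullet> \<phi>1 z\<bar> \<le> N1" using inner_basis_le[OF e] n(2) by (rule order_trans)
    then show "\<bar>lam e * ((e \<bullet> \<phi>1 z) * (e \<bullet> w z))\<bar> \<le> L * (N1 * norm (w z))"
      unfolding abs_mult using lam_bound[OF e] inner_basis_le[OF e, of "w z"] L_nonneg N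
      by (intro mult_mono) auto
  qed
  ultimately have "\<bar>weak_integrand \<phi> \<phi>1 \<phi>2 w z\<bar> \<le> N2 * norm (w z) + (\<Sum>e\<in>E. L * (N1 * norm (w z))) + N0 * (C * norm (w z))"
    unfolding weak_integrand_def by linarith
  then show ?thesis by (simp add: algebra_simps)
qed

lemma borel_measurable_weak_integrand:
  assumes "\<phi> \<in> borel_measurable borel" "\<phi>1 \<in> borel_measurable borel" "\<phi>2 \<in> borel_measurable borel" "w \<in> borel_measurable borel"
  shows "weak_integrand \<phi> \<phi>1 \<phi>2 w \<in> borel_measurable borel"
proof -
  have 1: "fst \<in> borel_measurable (borel :: (real \<times> real) measure)"
    by (auto intro!: borel_measurable_continuous_onI continuous_intros)
  show ?thesis unfolding weak_integrand_def[abs_def]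
    by (intro borel_measurable_add borel_measurable_sum borel_measurable_times borel_measurable_inner
        borel_measurable_const borel_measurable_B 1 assms)
qed


text \<open>Truncating the data gives mild solutions; since differences of mild solutions are mild solutions,
  the energy estimate makes them Cauchy in \<open>L2\<close>, uniformly in time. Along a rapidly converging
  subsequence they converge almost everywhere, and Fatou's lemma gives the error bounds.\<close>

lemma L2_solution_exists:
  assumes u: "u \<in> borel_measurable borel" and iu: "integrable lborel (\<lambda>x. (norm (u x))\<^sup>2)"
  shows "\<exists>U. U \<in> borel_measurable borel \<and> (\<forall>x. U (x, 0) = u x) \<and>
    (\<forall>t\<ge>0. integrable lborel (\<lambda>x. (norm (U (x, t)))\<^sup>2) \<and>
        (\<integral>x. (norm (U (x, t)))\<^sup>2 \<partial>lborel) \<le> (\<integral>x. (norm (u x))\<^sup>2 \<partial>lborel)) \<and>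
    (\<forall>t0\<ge>0. ((\<lambda>t. \<integral>x. (norm (U (x, t) - U (x, t0)))\<^sup>2 \<partial>lborel) \<longlongrightarrow> 0) (at t0 within {0..})) \<and>
    (\<forall>\<phi> \<phi>1 \<phi>2 R T. (\<forall>z. (\<phi> has_derivative (\<lambda>h. fst h *\<^sub>R \<phi>1 z + snd h *\<^sub>R \<phi>2 z)) (at z)) \<longrightarrow>
      continuous_on UNIV \<phi>1 \<longrightarrow> continuous_on UNIV \<phi>2 \<longrightarrow> R \<ge> 0 \<longrightarrow> T \<ge> 0 \<longrightarrow>
      (\<forall>x t. \<not> (\<bar>x\<bar> \<le> R \<and> 0 < t \<and> t < T) \<longrightarrow> \<phi> (x, t) = 0 \<and> \<phi>1 (x, t) = 0 \<and> \<phi>2 (x, t) = 0) \<longrightarrow>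
      integrable lborel (weak_integrand \<phi> \<phi>1 \<phi>2 U) \<and> integral\<^sup>L lborel (weak_integrand \<phi> \<phi>1 \<phi>2 U) = 0)"
proof -
  \<comment> \<open>Truncation in position and in size, to meet both requirements of
    \<open>mild_exists\<close>. At each x the truncation is eventually exact.\<close>
  define W where "W n x = (if \<bar>x\<bar> \<le> real n \<and> norm (u x) \<le> real n then u x else 0)" for n x
  have mW[measurable]: "W n \<in> borel_measurable borel" for n
    unfolding W_def using u by measurable
  have u'[measurable]: "u \<in> borel_measurable lborel" using u by simp
  have Wu: "norm (W n x) \<le> norm (u x)" for n x unfolding W_def by auto
  have Wlim: "\<forall>\<^sub>F n in sequentially. W n x = u x" for x
  proof -
    obtain m where m: "max \<bar>x\<bar> (norm (u x)) \<le> real m" using real_arch_simple by blast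
    show ?thesis using eventually_ge_at_top[of m]
    proof eventually_elim
      case (elim n)
      then have "real m \<le> real n" by simp
      then show ?case using m unfolding W_def by auto
    qed
  qed
  have "(\<lambda>n. \<integral>x. (norm (W n x - u x))\<^sup>2 \<partial>lborel) \<longlonglongrightarrow> (\<integral>x. 0 \<partial>(lborel::real measure))"
  proof (rule integral_dominated_convergence[where w = "\<lambda>x. (norm (u x))\<^sup>2"])
    show "AE x in lborel. (\<lambda>n. (norm (W n x - u x))\<^sup>2) \<longlonglongrightarrow> 0"
    proof (rule AE_I2)
      fix x
      show "(\<lambda>n. (norm (W n x - u x))\<^sup>2) \<longlonglongrightarrow> 0"
        by (rule tendsto_eventually) (use Wlim[of x] in \<open>eventually_elim, simp\<close>)
    qed
    show "AE x in lborel. norm ((norm (W n x - u x))\<^sup>2) \<le> (norm (u x))\<^sup>2" for n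
      unfolding W_def by (intro AE_I2) auto
  qed (use iu in auto)
  then have alim: "(\<lambda>n. \<integral>x. (norm (W n x - u x))\<^sup>2 \<partial>lborel) \<longlonglongrightarrow> 0" by simp
  \<comment> \<open>The subsequence is chosen for the rate (1/8)^n; keeping the index at least n
    preserves pointwise convergence of the data.\<close>
  have "\<exists>m\<ge>n. (\<integral>x. (norm (W m x - u x))\<^sup>2 \<partial>lborel) < (1/8) ^ n" for n
  proof -
    have "\<forall>\<^sub>F m in sequentially. (\<integral>x. (norm (W m x - u x))\<^sup>2 \<partial>lborel) < (1/8) ^ n \<and> m \<ge> n"
      by (intro eventually_conj order_tendstoD(2)[OF alim] eventually_ge_at_top) simp
    then show ?thesis unfolding eventually_sequentially by auto
  qed
  then obtain r where r: "\<And>n. r n \<ge> n" "\<And>n. (\<integral>x. (norm (W (r n) x - u x))\<^sup>2 \<partial>lborel) < (1/8) ^ n"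
    by metis
  have "\<exists>w. mild w \<and> (\<forall>x. w (x, 0) = W (r n) x)" for n
    by (rule mild_exists[where M = "real (r n)" and R = "real (r n)"]) (auto simp: W_def intro: mW)
  then obtain w where w: "\<And>n. mild (w n)" and w0: "\<And>n x. w n (x, 0) = W (r n) x" by metis
  have mw: "w n \<in> borel_measurable borel" for n by (rule mild_measurable[OF w])
  have mws: "(\<lambda>x. w n (x, t)) \<in> borel_measurable lborel" for n t
    using borel_measurable_compose_Pair[OF mw measurable_ident_sets[OF refl] borel_measurable_const, of n t] by simp
  have iWu: "integrable lborel (\<lambda>x. (norm (W n x - u x))\<^sup>2)" for n
  proof (rule Bochner_Integration.integrable_bound[OF iu])
    show "AE x in lborel. norm ((norm (W n x - u x))\<^sup>2) \<le> norm ((norm (u x))\<^sup>2)"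
      unfolding W_def by (intro AE_I2) auto
  qed measurable
  \<comment> \<open>The energy estimate for the difference reduces every time to time 0, where the
    distance is split through \<open>u\<close>: 2 (1/8)^n + 2 (1/8)^m is at most 4 (1/8)^n.\<close>
  have D: "integrable lborel (\<lambda>x. (norm (w n (x, t) - w m (x, t)))\<^sup>2)"
      "(\<integral>x. (norm (w n (x, t) - w m (x, t)))\<^sup>2 \<partial>lborel) \<le> 4 * (1/8) ^ n"
    if t: "t \<ge> 0" and nm: "n \<le> m" for n m t
  proof -
    have md: "mild (\<lambda>z. w n z - w m z)" by (intro mild_diff w)
    show "integrable lborel (\<lambda>x. (norm (w n (x, t) - w m (x, t)))\<^sup>2)"
      by (rule integrable_mild_norm_sq[OF md t])
    have "(\<integral>x. (norm (w n (x, t) - w m (x, t)))\<^sup>2 \<partial>lborel) \<le> (\<integral>x. (norm (w n (x, 0) - w m (x, 0)))\<^sup>2 \<partial>lborel)"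
      by (rule mild_energy[OF md t])
    also have "\<dots> = (\<integral>x. (norm ((W (r n) x - u x) - (W (r m) x - u x)))\<^sup>2 \<partial>lborel)" by (simp add: w0)
    also have "\<dots> \<le> 2 * (\<integral>x. (norm (W (r n) x - u x))\<^sup>2 \<partial>lborel) + 2 * (\<integral>x. (norm (W (r m) x - u x))\<^sup>2 \<partial>lborel)"
      by (rule norm_sq_diff_integrable(2)[OF _ _ iWu iWu]) measurable
    also have "\<dots> \<le> 2 * (1/8) ^ n + 2 * (1/8) ^ m"
      using r(2)[of n] r(2)[of m] by linarith
    also have "(1/8::real) ^ m \<le> (1/8) ^ n" using nm by (intro power_decreasing) auto
    finally show "(\<integral>x. (norm (w n (x, t) - w m (x, t)))\<^sup>2 \<partial>lborel) \<le> 4 * (1/8) ^ n" by simp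
  qed
  \<comment> \<open>One subsequence serves all times, so \<open>U\<close> is jointly measurable.
    Where the limit fails to exist the value is arbitrary; for each \<open>t \<ge> 0\<close> this
    concerns only a null set of x.\<close>
  define U where "U z = lim (\<lambda>n. w n z)" for z
  have mU: "U \<in> borel_measurable borel" unfolding U_def[abs_def] by (intro borel_measurable_lim_metric mw)
  have mUs: "(\<lambda>x. U (x, t)) \<in> borel_measurable lborel" for t
    using borel_measurable_compose_Pair[OF mU measurable_ident_sets[OF refl] borel_measurable_const, of t] by simp
  have conv: "AE x in lborel. (\<lambda>n. w n (x, t)) \<longlonglongrightarrow> U (x, t)" if t: "t \<ge> 0" for t
  proof -
    have "AE x in lborel. convergent (\<lambda>n. w n (x, t))"
    proof (rule AE_convergent_if_rapidly_Cauchy[where c = 4])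
      show "integrable lborel (\<lambda>x. (norm (w (Suc n) (x, t) - w n (x, t)))\<^sup>2)" for n
        using D(1)[OF t, of n "Suc n"] by (simp add: norm_minus_commute)
      show "(\<integral>x. (norm (w (Suc n) (x, t) - w n (x, t)))\<^sup>2 \<partial>lborel) \<le> 4 * (1/8) ^ n" for n
        using D(2)[OF t, of n "Suc n"] by (simp add: norm_minus_commute)
    qed (rule mws, simp)
    then show ?thesis by eventually_elim (simp add: U_def convergent_LIMSEQ_iff)
  qed
  \<comment> \<open>The initial value is attained at every x, not merely almost everywhere, because
    the truncated data are eventually constant in n at each point.\<close>
  have U0: "U (x, 0) = u x" for x
  proof -
    have "\<forall>\<^sub>F n in sequentially. W (r n) x = u x"
    proof -
      obtain N where N: "\<And>n. n \<ge> N \<Longrightarrow> W n x = u x" using Wlim[of x] unfolding eventually_sequentially by auto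
      show ?thesis using eventually_ge_at_top[of N]
        by eventually_elim (use N r(1) order_trans in blast)
    qed
    then have "(\<lambda>n. w n (x, 0)) \<longlonglongrightarrow> u x" unfolding w0 by (rule tendsto_eventually)
    then show ?thesis unfolding U_def by (rule limI)
  qed
  have Usq: "integrable lborel (\<lambda>x. (norm (U (x, t)))\<^sup>2)"
      "(\<integral>x. (norm (U (x, t)))\<^sup>2 \<partial>lborel) \<le> (\<integral>x. (norm (u x))\<^sup>2 \<partial>lborel)" if t: "t \<ge> 0" for t
  proof -
    have "integrable lborel (\<lambda>x. (norm (w n (x, t)))\<^sup>2) \<and>
        (\<integral>x. (norm (w n (x, t)))\<^sup>2 \<partial>lborel) \<le> (\<integral>x. (norm (u x))\<^sup>2 \<partial>lborel)" for n
    proof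
      show "integrable lborel (\<lambda>x. (norm (w n (x, t)))\<^sup>2)" by (rule integrable_mild_norm_sq[OF w t])
      have "(\<integral>x. (norm (w n (x, t)))\<^sup>2 \<partial>lborel) \<le> (\<integral>x. (norm (w n (x, 0)))\<^sup>2 \<partial>lborel)"
        by (rule mild_energy[OF w t])
      also have "\<dots> \<le> (\<integral>x. (norm (u x))\<^sup>2 \<partial>lborel)"
        unfolding w0 by (rule integral_mono'[OF iu]) (auto intro: power_mono Wu)
      finally show "(\<integral>x. (norm (w n (x, t)))\<^sup>2 \<partial>lborel) \<le> (\<integral>x. (norm (u x))\<^sup>2 \<partial>lborel)" .
    qed
    then have ev: "\<forall>\<^sub>F n in sequentially. integrable lborel (\<lambda>x. (norm (w n (x, t)))\<^sup>2) \<and>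
        (\<integral>x. (norm (w n (x, t)))\<^sup>2 \<partial>lborel) \<le> (\<integral>x. (norm (u x))\<^sup>2 \<partial>lborel)" by simp
    have c: "0 \<le> (\<integral>x. (norm (u x))\<^sup>2 \<partial>lborel)" by simp
    show "integrable lborel (\<lambda>x. (norm (U (x, t)))\<^sup>2)"
      "(\<integral>x. (norm (U (x, t)))\<^sup>2 \<partial>lborel) \<le> (\<integral>x. (norm (u x))\<^sup>2 \<partial>lborel)"
      using Fatou_norm_sq[OF mws mUs conv[OF t] ev c] by blast+
  qed
  \<comment> \<open>Fatou in the later index \<open>m\<close>, with \<open>n\<close> fixed, turns
    the Cauchy estimate \<open>D\<close> into an error bound uniform in time.\<close>
  have err: "integrable lborel (\<lambda>x. (norm (w n (x, t) - U (x, t)))\<^sup>2)"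
      "(\<integral>x. (norm (w n (x, t) - U (x, t)))\<^sup>2 \<partial>lborel) \<le> 4 * (1/8) ^ n" if t: "t \<ge> 0" for n t
  proof -
    have l: "AE x in lborel. (\<lambda>m. w n (x, t) - w m (x, t)) \<longlonglongrightarrow> w n (x, t) - U (x, t)"
      using conv[OF t] by eventually_elim (intro tendsto_intros)
    have ev: "\<forall>\<^sub>F m in sequentially. integrable lborel (\<lambda>x. (norm (w n (x, t) - w m (x, t)))\<^sup>2) \<and>
        (\<integral>x. (norm (w n (x, t) - w m (x, t)))\<^sup>2 \<partial>lborel) \<le> 4 * (1/8) ^ n"
      using eventually_ge_at_top[of n] by eventually_elim (intro conjI D t)
    show "integrable lborel (\<lambda>x. (norm (w n (x, t) - U (x, t)))\<^sup>2)"
      "(\<integral>x. (norm (w n (x, t) - U (x, t)))\<^sup>2 \<partial>lborel) \<le> 4 * (1/8) ^ n"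
      using Fatou_norm_sq[OF borel_measurable_diff[OF mws mws] borel_measurable_diff[OF mws mUs] l ev] by auto
  qed
  have cont: "((\<lambda>t. \<integral>x. (norm (U (x, t) - U (x, t0)))\<^sup>2 \<partial>lborel) \<longlongrightarrow> 0) (at t0 within {0..})" if t0: "t0 \<ge> 0" for t0
  proof (rule tendstoI)
    fix \<epsilon> :: real assume \<epsilon>: "\<epsilon> > 0"
    \<comment> \<open>With this n each squared error, at most 4 (1/8)^n, is below \<epsilon>/12. The
      final sum is then below 2 (\<epsilon>/8) + 8 (\<epsilon>/12) = (11/12) \<epsilon>.\<close>
    have lim8: "(\<lambda>n. 24 * (1/8::real) ^ n) \<longlonglongrightarrow> 24 * 0" by (intro tendsto_intros LIMSEQ_realpow_zero) auto
    have "\<forall>\<^sub>F n in sequentially. 24 * (1/8::real) ^ n < \<epsilon> / 2"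
      by (rule order_tendstoD(2)[OF lim8]) (use \<epsilon> in simp)
    then obtain n where n: "24 * (1/8::real) ^ n < \<epsilon> / 2" by (meson eventually_happens' sequentially_bot)
    have "\<forall>\<^sub>F t in at t0 within {0..}. (\<integral>x. (norm (w n (x, t) - w n (x, t0)))\<^sup>2 \<partial>lborel) < \<epsilon> / 8"
      by (rule order_tendstoD(2)[OF mild_continuous_in_time[OF w t0]]) (use \<epsilon> in simp)
    moreover have "\<forall>\<^sub>F t in at t0 within {0..}. t \<in> {0..}" by (simp add: eventually_at_filter)
    ultimately show "\<forall>\<^sub>F t in at t0 within {0..}. dist (\<integral>x. (norm (U (x, t) - U (x, t0)))\<^sup>2 \<partial>lborel) 0 < \<epsilon>"
    proof eventually_elim
      case (elim t)
      then have t: "t \<ge> 0" by simp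
      let ?a = "\<lambda>x. w n (x, t0) - U (x, t0)" and ?b = "\<lambda>x. w n (x, t) - U (x, t)" and ?c = "\<lambda>x. w n (x, t) - w n (x, t0)"
      note i = norm_sq_diff_integrable
      have ma: "?a \<in> borel_measurable lborel" and mb: "?b \<in> borel_measurable lborel" and mc: "?c \<in> borel_measurable lborel"
        by (intro borel_measurable_diff mws mUs)+
      have ic: "integrable lborel (\<lambda>x. (norm (?c x))\<^sup>2)"
        by (intro i(1) mws integrable_mild_norm_sq w t t0)
      have iba: "integrable lborel (\<lambda>x. (norm (?b x - ?a x))\<^sup>2)"
        by (intro i(1) ma mb err(1) t t0)
      have "(\<integral>x. (norm (U (x, t) - U (x, t0)))\<^sup>2 \<partial>lborel) = (\<integral>x. (norm (?c x - (?b x - ?a x)))\<^sup>2 \<partial>lborel)"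
        by (simp add: algebra_simps)
      also have "\<dots> \<le> 2 * (\<integral>x. (norm (?c x))\<^sup>2 \<partial>lborel) + 2 * (\<integral>x. (norm (?b x - ?a x))\<^sup>2 \<partial>lborel)"
        by (intro i(2) mc borel_measurable_diff ma mb ic iba)
      also have "(\<integral>x. (norm (?b x - ?a x))\<^sup>2 \<partial>lborel)
          \<le> 2 * (\<integral>x. (norm (?b x))\<^sup>2 \<partial>lborel) + 2 * (\<integral>x. (norm (?a x))\<^sup>2 \<partial>lborel)"
        by (intro i(2) ma mb err(1) t t0)
      finally have "(\<integral>x. (norm (U (x, t) - U (x, t0)))\<^sup>2 \<partial>lborel) \<le> 2 * (\<integral>x. (norm (?c x))\<^sup>2 \<partial>lborel)
          + 4 * (\<integral>x. (norm (?b x))\<^sup>2 \<partial>lborel) + 4 * (\<integral>x. (norm (?a x))\<^sup>2 \<partial>lborel)" by simp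
      also have "\<dots> < \<epsilon>" using elim(1) err(2)[OF t, of n] err(2)[OF t0, of n] n \<epsilon> by linarith
      finally show ?case by simp
    qed
  qed
  have weak: "integrable lborel (weak_integrand \<phi> \<phi>1 \<phi>2 U) \<and> integral\<^sup>L lborel (weak_integrand \<phi> \<phi>1 \<phi>2 U) = 0"
    if der: "\<forall>z. (\<phi> has_derivative (\<lambda>h. fst h *\<^sub>R \<phi>1 z + snd h *\<^sub>R \<phi>2 z)) (at z)"
      and c1: "continuous_on UNIV \<phi>1" and c2: "continuous_on UNIV \<phi>2" and R: "R \<ge> 0" and T: "T \<ge> 0"
      and box: "\<forall>x t. \<not> (\<bar>x\<bar> \<le> R \<and> 0 < t \<and> t < T) \<longrightarrow> \<phi> (x, t) = 0 \<and> \<phi>1 (x, t) = 0 \<and> \<phi>2 (x, t) = 0"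
    for \<phi> \<phi>1 \<phi>2 R T
  proof -
    have c0: "continuous_on UNIV \<phi>"
      by (intro continuous_at_imp_continuous_on ballI has_derivative_continuous[OF der[rule_format]])
    define K where "K = {-R..R} \<times> {0..T}"
    have K: "compact K" unfolding K_def by (intro compact_Times) auto
    have out: "\<phi> z = 0" "\<phi>1 z = 0" "\<phi>2 z = 0" if "z \<notin> K" for z
      using box[rule_format, of "fst z" "snd z"] that unfolding K_def by (auto simp: mem_Times_iff abs_le_iff)
    obtain N0 where N0: "N0 \<ge> 0" "\<And>z. norm (\<phi> z) \<le> N0"
      using bounded_if_continuous_compact_support[OF continuous_on_subset[OF c0] K out(1)] by auto
    obtain N1 where N1: "N1 \<ge> 0" "\<And>z. norm (\<phi>1 z) \<le> N1"
      using bounded_if_continuous_compact_support[OF continuous_on_subset[OF c1] K out(2)] by auto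
    obtain N2 where N2: "N2 \<ge> 0" "\<And>z. norm (\<phi>2 z) \<le> N2"
      using bounded_if_continuous_compact_support[OF continuous_on_subset[OF c2] K out(3)] by auto
    define N where "N = N2 + card E * (L * N1) + N0 * C"
    have N: "N \<ge> 0" unfolding N_def using N0 N1 N2 L_nonneg C_nonneg by simp
    let ?F = "weak_integrand \<phi> \<phi>1 \<phi>2"
    have mF: "?F v \<in> borel_measurable borel" if "v \<in> borel_measurable borel" for v
      by (intro borel_measurable_weak_integrand borel_measurable_continuous_onI c0 c1 c2 that)
    have iw: "integrable lborel (?F (w n))" and zw: "integral\<^sup>L lborel (?F (w n)) = 0" for n
      using mild_weak[OF w, of \<phi> \<phi>1 \<phi>2 T R] der c1 c2 T box by blast+
    \<comment> \<open>T times the bound for one time slice: \<open>4 * (1/8) ^ n\<close> is the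
      squared error from \<open>err\<close>, \<open>2 * R\<close> the width of the support, and the
      factors 2^n and (1/2)^n are those of \<open>le_weighted_square\<close>.\<close>
    define c where "c n = (N * (2 ^ n * (4 * (1/8) ^ n) + (1/2) ^ n * (2 * R))) * T" for n :: nat
    have c0: "c n \<ge> 0" for n unfolding c_def using N R T by simp
    have diff: "integrable lborel (\<lambda>z. norm (?F (w n) z - ?F U z)) \<and> (\<integral>z. norm (?F (w n) z - ?F U z) \<partial>lborel) \<le> c n" for n
    proof -
      let ?d = "\<lambda>x t. norm (w n (x, t) - U (x, t))"
      let ?G = "\<lambda>z. norm (?F (w n) z - ?F U z)"
      \<comment> \<open>On the support the Lipschitz bound is followed by
        \<open>le_weighted_square\<close>; off the support the integrands vanish. The indicator of
        the support keeps the remainder (1/2)^n integrable.\<close>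
      have pt: "?G (x, t) \<le> indicator {0..T} t * (N * (2 ^ n * (?d x t)\<^sup>2 + (1/2) ^ n * indicator {-R..R} x))" for x t
      proof (cases "(x, t) \<in> K")
        case True
        have "?G (x, t) \<le> N * ?d x t"
          unfolding weak_integrand_diff real_norm_def N_def by (rule weak_integrand_bound[OF N0(2) N1(2) N2(2)])
        also have "\<dots> \<le> N * (2 ^ n * (?d x t)\<^sup>2 + (1/2) ^ n)"
          by (intro mult_left_mono le_weighted_square N)
        finally show ?thesis using True by (simp add: K_def)
      next
        case False
        then have "?G (x, t) = 0" using out[of "(x, t)"] by (simp add: weak_integrand_def)
        then show ?thesis using N by simp
      qed
      have inner: "(\<integral>\<^sup>+x. ennreal (?G (x, t)) \<partial>lborel)
          \<le> ennreal (N * (2 ^ n * (4 * (1/8) ^ n) + (1/2) ^ n * (2 * R))) * indicator {0..T} t" for t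
      proof (cases "t \<in> {0..T}")
        case True
        then have t: "t \<ge> 0" by simp
        have ii: "integrable lborel (\<lambda>x. (1/2::real) ^ n * indicator {-R..R} x)"
        proof -
          have "integrable lborel (\<lambda>x. indicator {-R..R} x *\<^sub>R ((1/2::real) ^ n))"
            by (rule integrable_bounded_indicator[where M = "(1/2) ^ n"]) auto
          then show ?thesis by (simp add: mult.commute)
        qed
        have ib: "integrable lborel (\<lambda>x. N * (2 ^ n * (?d x t)\<^sup>2 + (1/2) ^ n * indicator {-R..R} x))"
          by (intro integrable_mult_right Bochner_Integration.integrable_add err(1)[OF t] ii)
        have "(\<integral>\<^sup>+x. ennreal (?G (x, t)) \<partial>lborel)
            \<le> (\<integral>\<^sup>+x. ennreal (N * (2 ^ n * (?d x t)\<^sup>2 + (1/2) ^ n * indicator {-R..R} x)) \<partial>lborel)"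
          using pt[of _ t] True by (intro nn_integral_mono ennreal_leI) auto
        also have "\<dots> = ennreal (\<integral>x. N * (2 ^ n * (?d x t)\<^sup>2 + (1/2) ^ n * indicator {-R..R} x) \<partial>lborel)"
          by (rule nn_integral_eq_integral[OF ib]) (use N in auto)
        also have "(\<integral>x. N * (2 ^ n * (?d x t)\<^sup>2 + (1/2) ^ n * indicator {-R..R} x) \<partial>lborel)
            = N * (2 ^ n * (\<integral>x. (?d x t)\<^sup>2 \<partial>lborel) + (1/2) ^ n * (2 * R))"
          using err(1)[OF t, of n] ii R by simp
        also have "ennreal \<dots> \<le> ennreal (N * (2 ^ n * (4 * (1/8) ^ n) + (1/2) ^ n * (2 * R)))"
          by (intro ennreal_leI mult_left_mono add_right_mono err(2)[OF t] N) simp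
        finally show ?thesis using True by simp
      next
        case False
        then have "?G (x, t) \<le> 0" for x using pt[of x t] by simp
        then have "ennreal (?G (x, t)) = 0" for x by (simp only: ennreal_eq_0_iff)
        then show ?thesis by (simp only: nn_integral_0_iff_AE) simp
      qed
      have mG: "?G \<in> borel_measurable borel"
        using mF[OF mw[of n]] mF[OF mU] by measurable
      have "(\<integral>\<^sup>+z. ennreal (?G z) \<partial>lborel) = (\<integral>\<^sup>+z. ennreal (?G z) \<partial>(lborel \<Otimes>\<^sub>M lborel))"
        by (simp add: lborel_prod)
      also have "\<dots> = (\<integral>\<^sup>+t. (\<integral>\<^sup>+x. ennreal (?G (x, t)) \<partial>lborel) \<partial>lborel)"
        by (rule lborel_pair.nn_integral_snd[symmetric])
          (use mG in \<open>simp add: lborel_prod\<close>)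
      also have "\<dots> \<le> (\<integral>\<^sup>+t. ennreal (N * (2 ^ n * (4 * (1/8) ^ n) + (1/2) ^ n * (2 * R))) * indicator {0..T} t \<partial>lborel)"
        by (intro nn_integral_mono inner)
      also have "\<dots> = ennreal (N * (2 ^ n * (4 * (1/8) ^ n) + (1/2) ^ n * (2 * R))) * ennreal T"
        using T by (subst nn_integral_cmult_indicator) auto
      also have "\<dots> = ennreal (c n)"
        unfolding c_def using N R T by (subst ennreal_mult) auto
      finally have fin: "(\<integral>\<^sup>+z. ennreal (?G z) \<partial>lborel) \<le> ennreal (c n)" .
      have mG': "?G \<in> borel_measurable lborel" using mG by simp
      have "integrable lborel ?G" by (rule integrable_le_nn_integral(1)[OF mG' norm_ge_zero fin c0])
      moreover have "integral\<^sup>L lborel ?G \<le> c n" by (rule integrable_le_nn_integral(2)[OF mG' norm_ge_zero fin c0])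
      ultimately show ?thesis by blast
    qed
    have iU: "integrable lborel (?F U)"
    proof -
      have "integrable lborel (\<lambda>z. ?F (w 0) z - ?F U z)"
      proof (rule integrable_norm_cancel)
        show "integrable lborel (\<lambda>z. norm (?F (w 0) z - ?F U z))" using diff[of 0] by blast
        show "(\<lambda>z. ?F (w 0) z - ?F U z) \<in> borel_measurable lborel"
          using borel_measurable_diff[OF mF[OF mw] mF[OF mU]] by simp
      qed
      from Bochner_Integration.integrable_diff[OF iw[of 0] this] show ?thesis by simp
    qed
    \<comment> \<open>The weak integrals of the approximations are exactly 0, so the one of
      \<open>U\<close> is bounded by the L1 distance of the integrands.\<close>
    have "\<bar>integral\<^sup>L lborel (?F U)\<bar> \<le> c n" for n
    proof -
      have "\<bar>integral\<^sup>L lborel (?F U)\<bar> = norm (\<integral>z. ?F (w n) z - ?F U z \<partial>lborel)"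
        using iw[of n] iU zw[of n] by simp
      also have "\<dots> \<le> c n"
        using integral_norm_bound[of lborel "\<lambda>z. ?F (w n) z - ?F U z"] diff[of n] by linarith
      finally show ?thesis .
    qed
    moreover have "c \<longlonglongrightarrow> 0"
    proof -
      have "c = (\<lambda>n. (N * (4 * (1/4) ^ n + (1/2) ^ n * (2 * R))) * T)"
      proof
        fix n
        have "(2::real) ^ n * (1/8) ^ n = (2 * (1/8)) ^ n" by (simp only: power_mult_distrib)
        then show "c n = (N * (4 * (1/4) ^ n + (1/2) ^ n * (2 * R))) * T" unfolding c_def by simp
      qed
      moreover have "(\<lambda>n. (N * (4 * (1/4) ^ n + (1/2) ^ n * (2 * R))) * T) \<longlonglongrightarrow> (N * (4 * 0 + 0 * (2 * R))) * T"
        by (intro tendsto_intros LIMSEQ_realpow_zero) auto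
      ultimately show ?thesis by simp
    qed
    ultimately have "\<bar>integral\<^sup>L lborel (?F U)\<bar> \<le> 0"
      using LIMSEQ_le_const by blast
    then show ?thesis using iU by simp
  qed
  show ?thesis
    by (rule exI[of _ U], intro conjI allI impI) (use mU U0 Usq cont weak in blast)+
qed

end

subsection \<open>The relaxation system\<close>

text \<open>\<open>Q\<close> sees only the coordinates in \<open>J\<close>, both in its argument and
  in its values. The quadratic form at v is therefore that of the projection u of v to these
  coordinates, where \<open>Q\<close> is negative definite unless u is zero.\<close>

lemma normalized_stability_dissipative:
  fixes A Q :: "real^('n::{finite,linorder})^('n::{finite,linorder})"
  assumes "normalized_stability A Q"
  shows "v \<bullet> (Q *v v) \<le> 0"
proof -
  from assms obtain J where J: "\<forall>i j. (i \<notin> J \<or> j \<notin> J) \<longrightarrow> Q $ i $ j = 0"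
    and neg: "\<forall>v :: real^('n::{finite,linorder}). (\<forall>i. i \<notin> J \<longrightarrow> v $ i = 0) \<and> v \<noteq> 0 \<longrightarrow> v \<bullet> (Q *v v) < 0"
    unfolding normalized_stability_def by (elim conjE exE)
  define u :: "real^('n::{finite,linorder})" where "u = (\<chi> i. if i \<in> J then v $ i else 0)"
  have Qu: "Q *v v = Q *v u"
    unfolding matrix_vector_mult_def u_def vec_eq_iff by (auto intro!: sum.cong simp: J)
  have z: "(Q *v u) $ i = 0" if "i \<notin> J" for i
    unfolding matrix_vector_mult_def using J that by simp
  have "v \<bullet> (Q *v u) = u \<bullet> (Q *v u)"
    unfolding inner_vec_def
  proof (rule sum.cong[OF refl])
    fix i
    have "u $ i = (if i \<in> J then v $ i else 0)" by (simp add: u_def)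
    then show "v $ i \<bullet> (Q *v u) $ i = u $ i \<bullet> (Q *v u) $ i" using z[of i] by auto
  qed
  moreover have "u \<bullet> (Q *v u) \<le> 0"
  proof (cases "u = 0")
    case False
    then show ?thesis using neg[rule_format, of u] by (simp add: u_def less_imp_le)
  qed simp
  ultimately show ?thesis by (simp add: Qu)
qed

lemma symmetric_matrix_inner:
  fixes A :: "real^'n^'n"
  assumes "transpose A = A"
  shows "x \<bullet> (A *v y) = (A *v x) \<bullet> y"
  using dot_lmul_matrix[of x A y] assms by (metis transpose_matrix_vector)

text \<open>Brings test functions into the form used by the locale: two continuous partial
  derivatives and a bounding box. Off the closed support the function vanishes on an open set, so
  its derivative vanishes there too.\<close>

lemma test_fun_pos_derivatives:
  fixes \<phi> :: "real \<times> real \<Rightarrow> 'b::real_normed_vector"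
  assumes "test_fun_pos \<phi>"
  defines "\<phi>1 \<equiv> \<lambda>z. frechet_derivative \<phi> (at z) (1, 0)" and "\<phi>2 \<equiv> \<lambda>z. frechet_derivative \<phi> (at z) (0, 1)"
  shows "(\<phi> has_derivative (\<lambda>h. fst h *\<^sub>R \<phi>1 z + snd h *\<^sub>R \<phi>2 z)) (at z)"
    "continuous_on UNIV \<phi>1" "continuous_on UNIV \<phi>2"
    "\<exists>R\<ge>0. \<exists>T\<ge>0. \<forall>x t. \<not> (\<bar>x\<bar> \<le> R \<and> 0 < t \<and> t < T) \<longrightarrow> \<phi> (x, t) = 0 \<and> \<phi>1 (x, t) = 0 \<and> \<phi>2 (x, t) = 0"
proof -
  have "Ck_fun (Suc 0) \<phi>" using assms(1) unfolding test_fun_pos_def smooth_fun_def by blast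
  then have d: "\<phi> differentiable_on UNIV" and c: "\<And>v. continuous_on UNIV (\<lambda>x. frechet_derivative \<phi> (at x) v)"
    by auto
  show "continuous_on UNIV \<phi>1" "continuous_on UNIV \<phi>2" unfolding \<phi>1_def \<phi>2_def by (rule c)+
  have D: "(\<phi> has_derivative frechet_derivative \<phi> (at z)) (at z)" for z
    using d unfolding differentiable_on_def by (intro frechet_derivative_works[THEN iffD1]) blast
  have fd: "frechet_derivative \<phi> (at z) h = fst h *\<^sub>R \<phi>1 z + snd h *\<^sub>R \<phi>2 z" for h z
  proof -
    note l = has_derivative_linear[OF D[of z]]
    have "frechet_derivative \<phi> (at z) h = frechet_derivative \<phi> (at z) (fst h *\<^sub>R (1, 0) + snd h *\<^sub>R (0, 1))"
      by (cases h) simp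
    then show ?thesis unfolding \<phi>1_def \<phi>2_def by (simp only: linear_add[OF l] linear_cmul[OF l])
  qed
  show "(\<phi> has_derivative (\<lambda>h. fst h *\<^sub>R \<phi>1 z + snd h *\<^sub>R \<phi>2 z)) (at z)"
    by (rule has_derivative_eq_rhs[OF D]) (rule ext, rule fd)
  have cpt: "compact (tsupp \<phi>)" and pos: "tsupp \<phi> \<subseteq> {z. snd z > 0}"
    using assms(1) unfolding test_fun_pos_def by auto
  obtain b where b: "\<And>z. z \<in> tsupp \<phi> \<Longrightarrow> norm z \<le> b"
    using compact_imp_bounded[OF cpt] unfolding bounded_iff by blast
  have out: "\<phi> z = 0 \<and> \<phi>1 z = 0 \<and> \<phi>2 z = 0" if z: "z \<notin> tsupp \<phi>" for z
  proof -
    have op: "open (- tsupp \<phi>)" unfolding tsupp_def by (intro open_Compl closed_closure)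
    have zero: "\<phi> y = 0" if "y \<in> - tsupp \<phi>" for y
      using that closure_subset[of "{x. \<phi> x \<noteq> 0}"] unfolding tsupp_def by auto
    have "(\<phi> has_derivative (\<lambda>_. 0)) (at z)"
      by (rule has_derivative_transform_within_open[OF has_derivative_const op]) (use z zero in auto)
    from frechet_derivative_at[OF this] have "frechet_derivative \<phi> (at z) = (\<lambda>_. 0)" by simp
    then show ?thesis using z zero unfolding \<phi>1_def \<phi>2_def by simp
  qed
  show "\<exists>R\<ge>0. \<exists>T\<ge>0. \<forall>x t. \<not> (\<bar>x\<bar> \<le> R \<and> 0 < t \<and> t < T) \<longrightarrow> \<phi> (x, t) = 0 \<and> \<phi>1 (x, t) = 0 \<and> \<phi>2 (x, t) = 0"
  \<comment> \<open>The norm bounds both coordinates by b on the support. Adding 1 makes t < T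
    strict, and \<open>max b 0\<close> covers an empty support, where b could be negative.\<close>
  proof (rule exI[of _ "max b 0"], rule conjI, simp, rule exI[of _ "max b 0 + 1"], rule conjI, simp, intro allI impI out notI)
    fix x t assume n: "\<not> (\<bar>x\<bar> \<le> max b 0 \<and> 0 < t \<and> t < max b 0 + 1)" and m: "(x, t) \<in> tsupp \<phi>"
    have "norm (x, t) \<le> b" by (rule b[OF m])
    then have "\<bar>x\<bar> \<le> b" "\<bar>t\<bar> \<le> b"
      using norm_fst_le[of x t] norm_snd_le[of t x] by auto
    moreover have "t > 0" using pos m by auto
    ultimately show False using n by auto
  qed
qed

lemma characteristic_system_exists:
  fixes A Q :: "real^('n::{finite,linorder})^('n::{finite,linorder})"
  assumes stab: "normalized_stability A Q" and \<epsilon>: "\<epsilon> > 0"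
  obtains E lam C L where "characteristic_system E lam (\<lambda>x v. (1 / eps_fun \<epsilon> x) *\<^sub>R (Q *v v)) C L"
    "\<And>e. e \<in> E \<Longrightarrow> A *v e = lam e *\<^sub>R e"
proof -
  have sym: "transpose A = A" using stab unfolding normalized_stability_def by blast
  have "linear (\<lambda>v. A *v v)" by (rule matrix_vector_mul_linear)
  moreover have "x \<bullet> (A *v y) = (A *v x) \<bullet> y" for x y by (rule symmetric_matrix_inner[OF sym])
  ultimately have "\<exists>E. finite E \<and> (\<forall>e\<in>E. \<forall>e'\<in>E. e \<bullet> e' = (if e = e' then 1 else 0)) \<and>
      (\<forall>v. (\<Sum>e\<in>E. (e \<bullet> v) *\<^sub>R e) = v) \<and> (\<forall>e\<in>E. \<exists>l. A *v e = l *\<^sub>R e)"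
    by (rule self_adjoint_orthonormal_eigenbasis)
  then obtain E where E: "finite E" "\<forall>e\<in>E. \<forall>e'\<in>E. e \<bullet> e' = (if e = e' then 1 else 0)"
    "\<forall>v. (\<Sum>e\<in>E. (e \<bullet> v) *\<^sub>R e) = v" "\<forall>e\<in>E. \<exists>l. A *v e = l *\<^sub>R e"
    by (elim exE conjE)
  from bchoice[OF E(4)] obtain lam where lam: "\<forall>e\<in>E. A *v e = lam e *\<^sub>R e" by (elim exE)
  obtain q where q: "q > 0" "\<And>v. norm (Q *v v) \<le> q * norm v"
    using linear_bounded_pos[OF matrix_vector_mul_linear[of Q]] by blast
  define B where "B x v = (1 / eps_fun \<epsilon> x) *\<^sub>R (Q *v v)" for x v
  define L where "L = (\<Sum>e\<in>E. \<bar>lam e\<bar>)"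
  have eps_pos: "eps_fun \<epsilon> x > 0" for x using \<epsilon> by (simp add: eps_fun_def)
  \<comment> \<open>The factor 1 / eps_fun takes only the values 1 and 1 / \<epsilon>, and q bounds
    the operator norm of \<open>Q\<close>; this gives the constant for \<open>B\<close>.\<close>
  have system: "characteristic_system E lam B (max 1 (1 / \<epsilon>) * q) L"
  proof (rule characteristic_system.intro)
    show "finite E" by (rule E(1))
    show "e \<bullet> e' = (if e = e' then 1 else 0)" if "e \<in> E" "e' \<in> E" for e e' using E(2) that by blast
    show "(\<Sum>e\<in>E. (e \<bullet> v) *\<^sub>R e) = v" for v using E(3) by blast
    show "\<bar>lam e\<bar> \<le> L" if "e \<in> E" for e
      unfolding L_def using E(1) that by (intro member_le_sum) auto
    show "L \<ge> 0" unfolding L_def by (intro sum_nonneg) auto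
    show "max 1 (1 / \<epsilon>) * q \<ge> 0" using q(1) by simp
    show "linear (B x)" for x
      unfolding B_def by (intro linear_compose_scale_right matrix_vector_mul_linear)
    show "norm (B x v) \<le> max 1 (1 / \<epsilon>) * q * norm v" for x v
    proof -
      have "norm (B x v) = (1 / eps_fun \<epsilon> x) * norm (Q *v v)"
        using eps_pos[of x] by (simp add: B_def)
      also have "\<dots> \<le> max 1 (1 / \<epsilon>) * (q * norm v)"
        using q eps_pos[of x] by (intro mult_mono) (auto simp: eps_fun_def)
      finally show ?thesis by (simp add: mult.assoc)
    qed
    show "(\<lambda>z. B (fst z) (snd z)) \<in> borel_measurable borel"
    proof -
      have 1: "(\<lambda>z :: real \<times> (real^('n::{finite,linorder})). Q *v snd z) \<in> borel_measurable borel"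
        by (intro borel_measurable_continuous_onI continuous_intros
            linear_continuous_on_compose[OF _ matrix_vector_mul_linear])
      have 2: "fst \<in> borel_measurable (borel :: (real \<times> (real^('n::{finite,linorder}))) measure)"
        by (auto intro!: borel_measurable_continuous_onI continuous_intros)
      have "(\<lambda>x. 1 / eps_fun \<epsilon> x) \<in> borel_measurable borel" unfolding eps_fun_def by measurable
      from measurable_compose[OF 2 this]
      show ?thesis unfolding B_def by (intro borel_measurable_scaleR 1)
    qed
    show "v \<bullet> B x v \<le> 0" for x v
      using normalized_stability_dissipative[OF stab, of v] eps_pos[of x]
      by (simp add: B_def divide_nonpos_pos)
  qed
  then show ?thesis using that[of E lam] lam unfolding B_def by blast
qed

lemma weak_solution_exists:
  fixes A Q :: "real^('n::{finite,linorder})^('n::{finite,linorder})" and U0 :: "real \<Rightarrow> real^('n::{finite,linorder})"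
  assumes stab: "normalized_stability A Q" and U0_L2: "in_L2 U0" and \<epsilon>: "\<epsilon> > 0"
  shows "\<exists>U. weak_solution A Q \<epsilon> U0 U \<and> (\<forall>t>0. L2norm (\<lambda>x. U x t) \<le> L2norm (\<lambda>x. U x 0))"
proof -
  define B where "B x v = (1 / eps_fun \<epsilon> x) *\<^sub>R (Q *v v)" for x v
  obtain E lam C L where system: "characteristic_system E lam B C L"
    and lam: "\<And>e. e \<in> E \<Longrightarrow> A *v e = lam e *\<^sub>R e"
    using characteristic_system_exists[OF stab \<epsilon>] unfolding B_def by blast
  have sym: "transpose A = A" using stab unfolding normalized_stability_def by blast
  let ?W = "characteristic_system.weak_integrand E lam B"
  have U0: "U0 \<in> borel_measurable borel" "integrable lborel (\<lambda>x. (norm (U0 x))\<^sup>2)"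
    using U0_L2 unfolding in_L2_def by auto
  obtain V where V: "V \<in> borel_measurable borel" "\<And>x. V (x, 0) = U0 x"
    and sq: "\<And>t. t \<ge> 0 \<Longrightarrow> integrable lborel (\<lambda>x. (norm (V (x, t)))\<^sup>2)"
      "\<And>t. t \<ge> 0 \<Longrightarrow> (\<integral>x. (norm (V (x, t)))\<^sup>2 \<partial>lborel) \<le> (\<integral>x. (norm (U0 x))\<^sup>2 \<partial>lborel)"
    and cont: "\<And>t0. t0 \<ge> 0 \<Longrightarrow> ((\<lambda>t. \<integral>x. (norm (V (x, t) - V (x, t0)))\<^sup>2 \<partial>lborel) \<longlongrightarrow> 0) (at t0 within {0..})"
    and weak: "\<forall>\<phi> \<phi>1 \<phi>2 R T. (\<forall>z. (\<phi> has_derivative (\<lambda>h. fst h *\<^sub>R \<phi>1 z + snd h *\<^sub>R \<phi>2 z)) (at z)) \<longrightarrow>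
      continuous_on UNIV \<phi>1 \<longrightarrow> continuous_on UNIV \<phi>2 \<longrightarrow> R \<ge> 0 \<longrightarrow> T \<ge> 0 \<longrightarrow>
      (\<forall>x t. \<not> (\<bar>x\<bar> \<le> R \<and> 0 < t \<and> t < T) \<longrightarrow> \<phi> (x, t) = 0 \<and> \<phi>1 (x, t) = 0 \<and> \<phi>2 (x, t) = 0) \<longrightarrow>
      integrable lborel (?W \<phi> \<phi>1 \<phi>2 V) \<and> integral\<^sup>L lborel (?W \<phi> \<phi>1 \<phi>2 V) = 0"
    using characteristic_system.L2_solution_exists[OF system U0] by auto
  \<comment> \<open>Symmetry moves \<open>A\<close> onto the eigenvector, which identifies the flux
    term of the weak formulation with the sum in \<open>weak_integrand\<close>.\<close>
  have A_expand: "p \<bullet> (A *v v) = (\<Sum>e\<in>E. lam e * ((e \<bullet> p) * (e \<bullet> v)))" for p v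
    by (subst characteristic_system.inner_expand[OF system]) (auto intro!: sum.cong simp: symmetric_matrix_inner[OF sym, of _ v] lam)
  have meas: "(\<lambda>x. V (x, t)) \<in> borel_measurable lborel" for t
    using borel_measurable_compose_Pair[OF V(1) measurable_ident_sets[OF refl] borel_measurable_const, of t] by simp
  define U where "U x t = V (x, t)" for x t
  have "weak_solution A Q \<epsilon> U0 U"
    unfolding weak_solution_def
  proof (intro conjI allI impI)
    show "(\<lambda>z. U (fst z) (snd z)) \<in> borel_measurable lborel" using V(1) by (simp add: U_def)
    show "in_L2 (\<lambda>x. U x t)" if "t \<ge> 0" for t using meas sq(1)[OF that] by (simp add: in_L2_def U_def)
    show "((\<lambda>t. \<integral>x. (norm (U x t - U x t0))\<^sup>2 \<partial>lborel) \<longlongrightarrow> 0) (at t0 within {0..})" if "t0 \<ge> 0" for t0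
      using cont[OF that] by (simp add: U_def)
    show "U x 0 = U0 x" for x by (simp add: U_def V(2))
    fix \<phi> :: "real \<times> real \<Rightarrow> real^('n::{finite,linorder})" assume \<phi>: "test_fun_pos \<phi>"
    let ?p1 = "\<lambda>z. frechet_derivative \<phi> (at z) (1, 0)" and ?p2 = "\<lambda>z. frechet_derivative \<phi> (at z) (0, 1)"
    note d = test_fun_pos_derivatives[OF \<phi>]
    obtain R T where RT: "R \<ge> 0" "T \<ge> 0"
      "\<forall>x t. \<not> (\<bar>x\<bar> \<le> R \<and> 0 < t \<and> t < T) \<longrightarrow> \<phi> (x, t) = 0 \<and> ?p1 (x, t) = 0 \<and> ?p2 (x, t) = 0"
      using d(4) by blast
    have w: "integrable lborel (?W \<phi> ?p1 ?p2 V) \<and> integral\<^sup>L lborel (?W \<phi> ?p1 ?p2 V) = 0"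
      by (rule weak[THEN spec[of _ \<phi>], THEN spec[of _ ?p1], THEN spec[of _ ?p2], THEN spec[of _ R], THEN spec[of _ T], rule_format])
        (rule d(1), rule d(2), rule d(3), rule RT(1), rule RT(2), rule RT(3)[rule_format], assumption)
    have eq: "(\<lambda>z. ?p2 z \<bullet> U (fst z) (snd z) + ?p1 z \<bullet> (A *v U (fst z) (snd z))
        + (1 / eps_fun \<epsilon> (fst z)) * (\<phi> z \<bullet> (Q *v U (fst z) (snd z)))) = ?W \<phi> ?p1 ?p2 V"
      by (auto simp: fun_eq_iff U_def characteristic_system.weak_integrand_def[OF system] A_expand B_def)
    show "let F = (\<lambda>z. ?p2 z \<bullet> U (fst z) (snd z) + ?p1 z \<bullet> (A *v U (fst z) (snd z))
        + (1 / eps_fun \<epsilon> (fst z)) * (\<phi> z \<bullet> (Q *v U (fst z) (snd z))))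
      in integrable lborel F \<and> integral\<^sup>L lborel F = 0"
      unfolding Let_def eq by (rule w)
  qed
  moreover have "L2norm (\<lambda>x. U x t) \<le> L2norm (\<lambda>x. U x 0)" if "t > 0" for t
    using sq(2)[of t] that by (simp add: L2norm_def U_def V(2))
  ultimately show "\<exists>U. weak_solution A Q \<epsilon> U0 U \<and> (\<forall>t>0. L2norm (\<lambda>x. U x t) \<le> L2norm (\<lambda>x. U x 0))"
    by blast
qed

theorem theorem2p2:
  fixes A Q :: "real^('n::{finite,linorder})^('n::{finite,linorder})" and U0 :: "real \<Rightarrow> real^('n::{finite,linorder})"
  assumes "normalized_stability A Q"
    and "det A \<noteq> 0"
    and "in_H1 U0"
  shows "\<forall>\<epsilon>>0. \<exists>U. weak_solution A Q \<epsilon> U0 U \<and>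
           (\<forall>t>0. L2norm (\<lambda>x. U x t) \<le> L2norm (\<lambda>x. U x 0))"
  using weak_solution_exists[OF assms(1)] assms(3) unfolding in_H1_def by blast

end
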